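(* Assume that the sequences $\{a_n,b_n,c_n,d_n\}$, $n\in\mathbb{N}$, are uniformly bounded, i.e. there exists $K\in\mathbb{R}_+$ such that $\max\{|a_n(t)|,|b_n(t)|,|c_n(t)|,|d_n(t)|\}\le K$ for all $n\in\mathbb{N}$ and $t\in\mathbb{R}$, and that $\dot a_1=c_1$. Then the following conditions are equivalent (each one being required for all $t\in\mathbb{R}$): (a) $\{a_n,b_n,c_n,d_n\}$, $n\in\mathbb{N}$, is a solution of $$\begin{cases}\dot a_n=c_n-c_{n-2}\\ \dot b_n=c_na_{n+1}-c_{n-1}a_n+d_n-d_{n-2}\\ \dot c_n=c_n(b_{n+1}-b_n)+d_na_{n+2}-d_{n-1}a_n\\ \dot d_n=d_n(b_{n+2}-b_n)\end{cases}\qquad n\in\mathbb{N},$$ that is, $\dot J=JJ_--J_-J$. (b) For each $n\in\mathbb{N}\cup\{0\}$, $\ \dfrac{d}{dt}J^n_{11}=J^{n+1}_{11}-J^n_{11}J_{11}+J^n_{11}(J_-)_{11}-(J_-)_{11}J^n_{11}$. (c) For each $n\in\mathbb{N}$, $\ \dot{\mathcal{U}}_n=\mathcal{U}_{n+1}-\mathcal{U}_n\,\mathcal{U}_1$. (d) For all $z\in\mathbb{C}$ with $|z|>\|J\|$, $\ \dot{\mathcal{F}}(z)=\mathcal{F}(z)(zI_{2\times2}-\mathcal{U}_1)-I_{2\times2}$. (e) For all $\mathcal{B}\in\mathbb{P}^2$, $\ \left(\dfrac{d}{dt}\mathcal{U}\right)(\mathcal{B})=\mathcal{U}(x^2\mathcal{B})-\mathcal{U}(\mathcal{B})\,\mathcal{U}_1$.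 (f) For all $m\in\mathbb{N}\cup\{0\}$, $\ \dot{\mathcal{B}}_m(x)=-C_m\mathcal{B}_{m-1}(x)-D_m\mathcal{B}_m(x)$, where $D_m=\begin{bmatrix}0&0\\ c_{2m+1}&0\end{bmatrix}$. (g) For all $m\in\mathbb{N}\cup\{0\}$, $\ \dot V_m(x)=-C_mV_{m-1}(x)-D_mV_m(x)$, with the same $D_m$.
   Context: $\mathbb{N}=\{1,2,\dots\}$. The $a_n,b_n,c_n,d_n$ ($n\in\mathbb{N}$) are differentiable functions of $t\in\mathbb{R}$; a dot denotes $d/dt$, and the $t$-dependence is suppressed in the notation. Conventions: $a_1(t)\in\mathbb{R}$; $a_0=b_0=c_0=d_0=0$, $c_{-1}=d_{-1}=0$; and $d_n(t)\ne0$ for all $n\ge1$. $J=J(t)$ is the semi-infinite banded matrix (rows, columns indexed from $1$) with entries $J_{n,n}=b_n$, $J_{n,n+1}=a_{n+1}$, $J_{n,n+2}=1$, $J_{n+1,n}=c_n$, $J_{n+2,n}=d_n$ and zero elsewhere, viewed as a bounded operator on $\ell^2$; $J_-$ is its strictly lower triangular part. The derivative $\dot J$ is entrywise. $\|J\|$ is the operator norm, understood as $\sup_t\|J(t)\|$. In conditions (b)–(g), for an infinite matrix $X$, $X_{ij}$ denotes its $2\times2$ block formed by rows $2i-1,2i$ and columns $2j-1,2j$; $J^n_{11}$ is the $(1,1)$ block of $J^n$; thus $J_{11}=\begin{bmatrix}b_1&a_2\\ c_1&b_2\end{bmatrix}$, $(J_-)_{11}=\begin{bmatrix}0&0\\ c_1&0\end{bmatrix}$.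 For $m\ge0$ put $$A_m=\begin{bmatrix}1&0\\ a_{2m+3}&1\end{bmatrix},\quad B_m=\begin{bmatrix}b_{2m+1}&a_{2m+2}\\ c_{2m+1}&b_{2m+2}\end{bmatrix},\quad C_m=\begin{bmatrix}d_{2m-1}&c_{2m}\\ 0&d_{2m}\end{bmatrix}.$$ Let $\mathbb{P}$ be the space of complex polynomials in $x$, $\mathcal{P}_0(x)=[1\ \ x]^T$, and $\mathbb{P}^2$ the set of column vectors $[p_1\ p_2]^T$, $p_i\in\mathbb{P}$. The vector polynomials $\mathcal{B}_m$ are defined by $\mathcal{B}_{-1}=0_{2\times1}$, $\mathcal{B}_0(x)=[1\ \ x-a_1]^T$ and $x^2\mathcal{B}_m(x)=A_m\mathcal{B}_{m+1}(x)+B_m\mathcal{B}_m(x)+C_m\mathcal{B}_{m-1}(x)$, $m\ge0$. The $2\times2$ matrix polynomials $V_m$ (of degree $m$) are determined by $\mathcal{B}_m(x)=V_m(x^2)\mathcal{P}_0(x)$, with $V_{-1}=0_{2\times2}$. A vector of linear functionals $\mathcal{U}=[u^1\ u^2]^T$ (with $u^1,u^2$ linear functionals on $\mathbb{P}$) acts on $\mathcal{P}=[p_1\ p_2]^T\in\mathbb{P}^2$ by $$\mathcal{U}(\mathcal{P})=\begin{bmatrix}\langle u^1,p_1\rangle&\langle u^2,p_1\rangle\\ \langle u^1,p_2\rangle&\langle u^2,p_2\rangle\end{bmatrix},\qquad (x^{k}\mathcal{U})(\mathcal{P})=\mathcal{U}(x^{k}\mathcal{P}).$$ For each $t$, $\mathcal{U}=\mathcal{U}(t)$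 denotes the vector of linear functionals that is normalized, i.e. $\mathcal{U}(\mathcal{P}_0)=I_{2\times2}$, and with respect to which $\{\mathcal{B}_m\}$ is left-orthogonal, i.e. $(x^{2k}\mathcal{U})(\mathcal{B}_m)=\Delta_m\delta_{k,m}$ for $k=0,\dots,m$, $m\ge0$, where $\Delta_m=C_m\cdots C_1\Delta_0$ for $m\ge1$ and $\Delta_0$ is a non-singular $2\times2$ matrix. Its moments are $\mathcal{U}_n=\mathcal{U}(x^{2n}\mathcal{P}_0)$, and its generalized Markov function is $\mathcal{F}(z)=\sum_{n=0}^\infty \mathcal{U}_n/z^{n+1}$, $|z|>\|J\|$. The derivative $\frac{d}{dt}\mathcal{U}$ is defined by $\left(\frac{d}{dt}\mathcal{U}\right)(\mathcal{P})=\lim_{h\to0}\frac{\mathcal{U}(t+h)(\mathcal{P})-\mathcal{U}(t)(\mathcal{P})}{h}$ for each fixed ($t$-independent) $\mathcal{P}\in\mathbb{P}^2$. *)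

theory Defs
  imports "HOL-Analysis.Analysis" "HOL-Computational_Algebra.Polynomial"
begin

section \<open>Semi-infinite matrices\<close>

text \<open>
  Rows and columns of a semi-infinite matrix are numbered from 1; the entries with an index 0
  are never used.
\<close>

type_synonym imat = "nat \<Rightarrow> nat \<Rightarrow> complex"

definition imat_mult :: "imat \<Rightarrow> imat \<Rightarrow> imat" where
  "imat_mult X Y = (\<lambda>i j. \<Sum>\<^sub>\<infinity>k\<in>{1..}. X i k * Y k j)"

primrec imat_power :: "imat \<Rightarrow> nat \<Rightarrow> imat" where
  "imat_power X 0 = (\<lambda>i j. if i = j then 1 else 0)"
| "imat_power X (Suc n) = imat_mult X (imat_power X n)"

definition imat_lower :: "imat \<Rightarrow> imat" where
  "imat_lower X = (\<lambda>i j. if j < i then X i j else 0)"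

definition mat2 :: "'a::zero \<Rightarrow> 'a \<Rightarrow> 'a \<Rightarrow> 'a \<Rightarrow> 'a^2^2" where
  "mat2 p q r s = vector [vector [p, q], vector [r, s]]"

definition imat_block :: "imat \<Rightarrow> nat \<Rightarrow> nat \<Rightarrow> complex^2^2" where
  "imat_block X i j =
     mat2 (X (2*i - 1) (2*j - 1)) (X (2*i - 1) (2*j))
          (X (2*i) (2*j - 1)) (X (2*i) (2*j))"

definition ell2 :: "(nat \<Rightarrow> complex) set" where
  "ell2 = {x. (\<lambda>i. (cmod (x i))\<^sup>2) summable_on {1..}}"

definition ell2_norm :: "(nat \<Rightarrow> complex) \<Rightarrow> real" where
  "ell2_norm x = sqrt (\<Sum>\<^sub>\<infinity>i\<in>{1..}. (cmod (x i))\<^sup>2)"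

definition imat_apply :: "imat \<Rightarrow> (nat \<Rightarrow> complex) \<Rightarrow> nat \<Rightarrow> complex" where
  "imat_apply X x = (\<lambda>i. \<Sum>\<^sub>\<infinity>j\<in>{1..}. X i j * x j)"

text \<open>
  Meaningful for matrices that are bounded operators on \<open>\<ell>\<^sup>2\<close>, in particular for banded matrices
  with bounded entries; otherwise the supremum of reals is unspecified.
\<close>

definition imat_norm :: "imat \<Rightarrow> real" where
  "imat_norm X = (SUP x\<in>{x \<in> ell2. ell2_norm x \<le> 1}. ell2_norm (imat_apply X x))"


section \<open>The pentadiagonal matrix and its blocks\<close>

text \<open>
  The coefficients at a fixed time are sequences \<open>nat \<Rightarrow> complex\<close> that vanish at index 0.  The
  index \<open>-1\<close> only occurs for \<open>c\<close> and \<open>d\<close>, where the value is also 0 by convention; truncated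
  subtraction sends it to the index 0 and hence to the right value.
\<close>

type_synonym cseq = "nat \<Rightarrow> complex"

definition Jmat :: "cseq \<Rightarrow> cseq \<Rightarrow> cseq \<Rightarrow> cseq \<Rightarrow> imat" where
  "Jmat a b c d = (\<lambda>i j.
     if j = i then b i
     else if j = i + 1 then a (i + 1)
     else if j = i + 2 then 1
     else if i = j + 1 then c j
     else if i = j + 2 then d j
     else 0)"

definition Ablk :: "cseq \<Rightarrow> nat \<Rightarrow> complex^2^2" where
  "Ablk a m = mat2 1 0 (a (2*m + 3)) 1"

definition Bblk :: "cseq \<Rightarrow> cseq \<Rightarrow> cseq \<Rightarrow> nat \<Rightarrow> complex^2^2" where
  "Bblk a b c m = mat2 (b (2*m + 1)) (a (2*m + 2)) (c (2*m + 1)) (b (2*m + 2))"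

definition Cblk :: "cseq \<Rightarrow> cseq \<Rightarrow> nat \<Rightarrow> complex^2^2" where
  "Cblk c d m = mat2 (d (2*m - 1)) (c (2*m)) 0 (d (2*m))"

definition Dblk :: "cseq \<Rightarrow> nat \<Rightarrow> complex^2^2" where
  "Dblk c m = mat2 0 0 (c (2*m + 1)) 0"


section \<open>Vector polynomials\<close>

text \<open>\<open>prev f m\<close> stands for \<open>f (m - 1)\<close> with the convention \<open>f (-1) = 0\<close>.\<close>

definition prev :: "(nat \<Rightarrow> 'a::zero) \<Rightarrow> nat \<Rightarrow> 'a" where
  "prev f m = (case m of 0 \<Rightarrow> 0 | Suc k \<Rightarrow> f k)"

definition const_mat :: "complex^2^2 \<Rightarrow> complex poly^2^2" where
  "const_mat M = map_matrix (\<lambda>z. [:z:]) M"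

definition Pvec0 :: "complex poly^2" where
  "Pvec0 = vector [1, [:0, 1:]]"

text \<open>
  The three-term recurrence solved for its term of highest index; the form
  \<open>x\<^sup>2 B\<^sub>m = A\<^sub>m B\<^sub>m\<^sub>+\<^sub>1 + B\<^sub>m B\<^sub>m + C\<^sub>m B\<^sub>m\<^sub>-\<^sub>1\<close> is \<open>Bvec_recurrence\<close> below.
\<close>

fun Bvec :: "cseq \<Rightarrow> cseq \<Rightarrow> cseq \<Rightarrow> cseq \<Rightarrow> nat \<Rightarrow> complex poly^2" where
  "Bvec a b c d 0 = vector [1, [:- a 1, 1:]]"
| "Bvec a b c d (Suc 0) =
     const_mat (matrix_inv (Ablk a 0)) *v
       (monom 1 2 *s Bvec a b c d 0 - const_mat (Bblk a b c 0) *v Bvec a b c d 0)"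
| "Bvec a b c d (Suc (Suc m)) =
     const_mat (matrix_inv (Ablk a (Suc m))) *v
       (monom 1 2 *s Bvec a b c d (Suc m)
        - const_mat (Bblk a b c (Suc m)) *v Bvec a b c d (Suc m)
        - const_mat (Cblk c d (Suc m)) *v Bvec a b c d m)"

lemma invertible_Ablk: "invertible (Ablk a m)"
  by (simp add: invertible_det_nz det_2 Ablk_def mat2_def)

lemma const_mat_mult: "const_mat (X ** Y) = const_mat X ** const_mat Y"
  by (simp add: const_mat_def map_matrix_def matrix_matrix_mult_def vec_eq_iff sum_2)

lemma const_mat_1: "const_mat (mat 1) = mat 1"
  by (simp add: const_mat_def map_matrix_def mat_def vec_eq_iff)

lemma const_mat_matrix_inv:
  assumes "invertible X"
  shows "const_mat X *v (const_mat (matrix_inv X) *v v) = v"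
proof -
  have "X ** matrix_inv X = mat 1"
    using assms unfolding invertible_def matrix_inv_def by (rule someI2_ex) simp
  then show ?thesis
    by (simp add: matrix_vector_mul_assoc const_mat_mult [symmetric] const_mat_1)
qed

lemma Bvec_recurrence:
  "monom 1 2 *s Bvec a b c d m =
     const_mat (Ablk a m) *v Bvec a b c d (Suc m)
     + const_mat (Bblk a b c m) *v Bvec a b c d m
     + const_mat (Cblk c d m) *v prev (Bvec a b c d) m"
  by (cases m) (simp_all add: const_mat_matrix_inv invertible_Ablk prev_def)

text \<open>\<open>at_square M\<close> is the matrix polynomial \<open>M(x\<^sup>2)\<close>.\<close>

definition at_square :: "complex poly^2^2 \<Rightarrow> complex poly^2^2" where
  "at_square M = map_matrix (\<lambda>p. p \<circ>\<^sub>p monom 1 2) M"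

definition Vmat :: "cseq \<Rightarrow> cseq \<Rightarrow> cseq \<Rightarrow> cseq \<Rightarrow> nat \<Rightarrow> complex poly^2^2" where
  "Vmat a b c d m = (THE M. Bvec a b c d m = at_square M *v Pvec0)"

lemma even_odd_split_exists:
  fixes p :: "complex poly"
  shows "\<exists>q r. p = q \<circ>\<^sub>p monom 1 2 + [:0, 1:] * (r \<circ>\<^sub>p monom 1 2)"
proof (induction p)
  case 0
  show ?case by (intro exI [of _ 0]) simp
next
  case (pCons z p)
  then obtain q r where "p = q \<circ>\<^sub>p monom 1 2 + [:0, 1:] * (r \<circ>\<^sub>p monom 1 2)"
    by blast
  then have "pCons z p = pCons z r \<circ>\<^sub>p monom 1 2 + [:0, 1:] * (q \<circ>\<^sub>p monom 1 2)"
    by (simp add: pcompose_pCons monom_altdef algebra_simps power2_eq_square)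
  then show ?case by blast
qed

lemma coeff_pcompose_square:
  fixes p :: "complex poly"
  shows "coeff (p \<circ>\<^sub>p monom 1 2) n = (if even n then coeff p (n div 2) else 0)"
proof (induction p arbitrary: n)
  case (pCons z p)
  show ?case
  proof (cases "n < 2")
    case True
    then show ?thesis
      by (auto simp: pcompose_pCons coeff_monom_mult less_2_cases_iff)
  next
    case False
    then obtain k where "n = Suc (Suc k)"
      by (metis add_2_eq_Suc le_Suc_ex not_less)
    then show ?thesis
      by (simp add: pcompose_pCons coeff_monom_mult pCons.IH)
  qed
qed simp

lemma even_odd_split_zero:
  fixes q r :: "complex poly"
  assumes "q \<circ>\<^sub>p monom 1 2 + [:0, 1:] * (r \<circ>\<^sub>p monom 1 2) = 0"
  shows "q = 0" "r = 0"
proof -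
  have "coeff q n = 0" for n
  proof -
    have "coeff ([:0, 1:] * (r \<circ>\<^sub>p monom 1 2)) (2*n) = 0"
      by (cases n) (simp_all add: coeff_pcompose_square)
    then have "coeff (q \<circ>\<^sub>p monom 1 2) (2*n) = 0"
      using arg_cong [OF assms, of "\<lambda>p. coeff p (2*n)"] by (simp only: coeff_add coeff_0 add_0_right)
    then show ?thesis
      unfolding coeff_pcompose_square by simp
  qed
  then show "q = 0" by (simp add: poly_eq_iff)
  have "coeff r n = 0" for n
    using arg_cong [OF assms, of "\<lambda>p. coeff p (Suc (2*n))"]
    by (simp add: coeff_pcompose_square)
  then show "r = 0" by (simp add: poly_eq_iff)
qed

lemma ex1_at_square: "\<exists>!M. P = at_square M *v Pvec0"
proof -
  have Pvec0: "Pvec0 $ 1 = 1" "Pvec0 $ 2 = [:0, 1:]"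
    by (simp_all add: Pvec0_def)
  have eq: "P = at_square M *v Pvec0 \<longleftrightarrow>
      (\<forall>i. P $ i = (M $ i $ 1) \<circ>\<^sub>p monom 1 2 + [:0, 1:] * ((M $ i $ 2) \<circ>\<^sub>p monom 1 2))" for M
    by (simp add: vec_eq_iff at_square_def matrix_vector_mult_def sum_2 Pvec0)
  obtain q r where
    qr: "\<And>i. P $ i = q i \<circ>\<^sub>p monom 1 2 + [:0, 1:] * (r i \<circ>\<^sub>p monom 1 2)"
    using even_odd_split_exists [of "P $ _"] by metis
  show ?thesis
  proof (rule ex1I)
    show "P = at_square (\<chi> i j. if j = 1 then q i else r i) *v Pvec0"
      unfolding eq using qr by simp
  next
    fix M assume M: "P = at_square M *v Pvec0"
    have "M $ i $ 1 - q i = 0 \<and> M $ i $ 2 - r i = 0" for i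
    proof -
      have "(M $ i $ 1 - q i) \<circ>\<^sub>p monom 1 2 + [:0, 1:] * ((M $ i $ 2 - r i) \<circ>\<^sub>p monom 1 2)
          = (M $ i $ 1 \<circ>\<^sub>p monom 1 2 + [:0, 1:] * (M $ i $ 2 \<circ>\<^sub>p monom 1 2))
            - (q i \<circ>\<^sub>p monom 1 2 + [:0, 1:] * (r i \<circ>\<^sub>p monom 1 2))"
        by (simp only: pcompose_diff right_diff_distrib add_diff_add)
      also have "\<dots> = P $ i - P $ i"
        using M [unfolded eq, rule_format, of i] qr [of i] by simp
      finally have "(M $ i $ 1 - q i) \<circ>\<^sub>p monom 1 2
          + [:0, 1:] * ((M $ i $ 2 - r i) \<circ>\<^sub>p monom 1 2) = 0"
        by (simp only: diff_self)
      then show ?thesis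
        using even_odd_split_zero by blast
    qed
    then show "M = (\<chi> i j. if j = 1 then q i else r i)"
      by (simp add: vec_eq_iff forall_2)
  qed
qed

lemma Vmat: "Bvec a b c d m = at_square (Vmat a b c d m) *v Pvec0"
  unfolding Vmat_def by (rule theI' [OF ex1_at_square])

definition eval_vec :: "complex poly^2 \<Rightarrow> complex \<Rightarrow> complex^2" where
  "eval_vec P x = (\<chi> i. poly (P $ i) x)"

definition eval_mat :: "complex poly^2^2 \<Rightarrow> complex \<Rightarrow> complex^2^2" where
  "eval_mat M x = map_matrix (\<lambda>p. poly p x) M"


section \<open>Vectors of linear functionals\<close>

type_synonym fvec = "(complex poly \<Rightarrow> complex)^2"

definition linear_functionals :: "fvec \<Rightarrow> bool" where
  "linear_functionals U \<longleftrightarrow> (\<forall>j. Vector_Spaces.linear smult (*) (U $ j))"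

definition fapply :: "fvec \<Rightarrow> complex poly^2 \<Rightarrow> complex^2^2" where
  "fapply U P = (\<chi> i j. (U $ j) (P $ i))"

definition fshift :: "nat \<Rightarrow> fvec \<Rightarrow> fvec" where
  "fshift k U = (\<chi> j. (\<lambda>p. (U $ j) (monom 1 k * p)))"

lemma fapply_fshift: "fapply (fshift k U) P = fapply U (monom 1 k *s P)"
  by (simp add: fapply_def fshift_def vector_scalar_mult_def)

definition normalized :: "fvec \<Rightarrow> bool" where
  "normalized U \<longleftrightarrow> fapply U Pvec0 = mat 1"

definition left_orthogonal :: "cseq \<Rightarrow> cseq \<Rightarrow> cseq \<Rightarrow> cseq \<Rightarrow> fvec \<Rightarrow> bool" where
  "left_orthogonal a b c d U \<longleftrightarrow>
     (\<exists>\<Delta> :: nat \<Rightarrow> complex^2^2.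
        invertible (\<Delta> 0) \<and> (\<forall>m. \<Delta> (Suc m) = Cblk c d (Suc m) ** \<Delta> m) \<and>
        (\<forall>m. \<forall>k\<le>m. fapply (fshift (2*k) U) (Bvec a b c d m) = (if k = m then \<Delta> m else 0)))"

definition moment :: "fvec \<Rightarrow> nat \<Rightarrow> complex^2^2" where
  "moment U n = fapply U (monom 1 (2*n) *s Pvec0)"

definition markov :: "fvec \<Rightarrow> complex \<Rightarrow> complex^2^2" where
  "markov U z = (\<Sum>n. map_matrix (\<lambda>u. u / z ^ (n + 1)) (moment U n))"


section \<open>The conditions on the time evolution\<close>

text \<open>The coefficient \<open>a\<^sub>n(t)\<close> is \<open>a t n\<close>, and similarly for the others.\<close>

type_synonym tseq = "real \<Rightarrow> nat \<Rightarrow> complex"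

definition toda_system :: "tseq \<Rightarrow> tseq \<Rightarrow> tseq \<Rightarrow> tseq \<Rightarrow> bool" where
  "toda_system a b c d \<longleftrightarrow> (\<forall>t. \<forall>n\<ge>1.
     ((\<lambda>s. a s n) has_vector_derivative c t n - c t (n - 2)) (at t) \<and>
     ((\<lambda>s. b s n) has_vector_derivative
        c t n * a t (n + 1) - c t (n - 1) * a t n + d t n - d t (n - 2)) (at t) \<and>
     ((\<lambda>s. c s n) has_vector_derivative
        c t n * (b t (n + 1) - b t n) + d t n * a t (n + 2) - d t (n - 1) * a t n) (at t) \<and>
     ((\<lambda>s. d s n) has_vector_derivative d t n * (b t (n + 2) - b t n)) (at t))"

definition lax_equation :: "(real \<Rightarrow> imat) \<Rightarrow> bool" where
  "lax_equation J \<longleftrightarrow> (\<forall>t. \<forall>i\<ge>1. \<forall>j\<ge>1.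
     ((\<lambda>s. J s i j) has_vector_derivative
        imat_mult (J t) (imat_lower (J t)) i j - imat_mult (imat_lower (J t)) (J t) i j) (at t))"

definition block_power_evolution :: "(real \<Rightarrow> imat) \<Rightarrow> bool" where
  "block_power_evolution J \<longleftrightarrow> (\<forall>t n.
     ((\<lambda>s. imat_block (imat_power (J s) n) 1 1) has_vector_derivative
        imat_block (imat_power (J t) (n + 1)) 1 1
        - imat_block (imat_power (J t) n) 1 1 ** imat_block (J t) 1 1
        + imat_block (imat_power (J t) n) 1 1 ** imat_block (imat_lower (J t)) 1 1
        - imat_block (imat_lower (J t)) 1 1 ** imat_block (imat_power (J t) n) 1 1) (at t))"

definition moment_evolution :: "(real \<Rightarrow> fvec) \<Rightarrow> bool" where
  "moment_evolution U \<longleftrightarrow> (\<forall>t. \<forall>n\<ge>1.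
     ((\<lambda>s. moment (U s) n) has_vector_derivative
        moment (U t) (n + 1) - moment (U t) n ** moment (U t) 1) (at t))"

definition markov_evolution :: "(real \<Rightarrow> imat) \<Rightarrow> (real \<Rightarrow> fvec) \<Rightarrow> bool" where
  "markov_evolution J U \<longleftrightarrow> (\<forall>t z. cmod z > (SUP s. imat_norm (J s)) \<longrightarrow>
     ((\<lambda>s. markov (U s) z) has_vector_derivative
        markov (U t) z ** (mat z - moment (U t) 1) - mat 1) (at t))"

definition functional_evolution :: "(real \<Rightarrow> fvec) \<Rightarrow> bool" where
  "functional_evolution U \<longleftrightarrow> (\<forall>t P.
     (\<lambda>h. (fapply (U (t + h)) P - fapply (U t) P) /\<^sub>R h) \<midarrow>0\<rightarrow>
       fapply (U t) (monom 1 2 *s P) - fapply (U t) P ** moment (U t) 1)"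

definition Bvec_evolution :: "tseq \<Rightarrow> tseq \<Rightarrow> tseq \<Rightarrow> tseq \<Rightarrow> bool" where
  "Bvec_evolution a b c d \<longleftrightarrow> (\<forall>t m x.
     ((\<lambda>s. eval_vec (Bvec (a s) (b s) (c s) (d s) m) x) has_vector_derivative
        - (Cblk (c t) (d t) m *v eval_vec (prev (Bvec (a t) (b t) (c t) (d t)) m) x)
        - Dblk (c t) m *v eval_vec (Bvec (a t) (b t) (c t) (d t) m) x) (at t))"

definition Vmat_evolution :: "tseq \<Rightarrow> tseq \<Rightarrow> tseq \<Rightarrow> tseq \<Rightarrow> bool" where
  "Vmat_evolution a b c d \<longleftrightarrow> (\<forall>t m x.
     ((\<lambda>s. eval_mat (Vmat (a s) (b s) (c s) (d s) m) x) has_vector_derivative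
        - (Cblk (c t) (d t) m ** eval_mat (prev (Vmat (a t) (b t) (c t) (d t)) m) x)
        - Dblk (c t) m ** eval_mat (Vmat (a t) (b t) (c t) (d t) m) x) (at t))"

end

theory Submission
  imports Defs
begin

text \<open>
  The entries of \<open>\<B>\<^sub>m\<close> are the scalar polynomials \<open>p (2m + 1)\<close> and \<open>p (2m + 2)\<close>, where \<open>p i\<close> is
  monic of degree \<open>i - 1\<close> and \<open>x\<^sup>2 p i = \<Sum>\<^sub>j J i j * p j\<close>. In these terms (f) reads \<open>p' = - J\<^sub>- p\<close>.
  Let \<open>r = p' + J\<^sub>- p\<close>. Differentiating the recurrence gives
  \<open>x\<^sup>2 r - J r = (J' - (J J\<^sub>- - J\<^sub>- J)) p\<close>, and \<open>r 1 = r 2 = 0\<close> because \<open>a\<^sub>1' = c\<^sub>1\<close>; hence (a) and (f) are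
  both equivalent to \<open>r = 0\<close>, and (g) is (f) split into even and odd parts.

  The vector \<open>\<U>\<close> is determined by its values on the \<open>p i\<close>: the combinations \<open>v = u\<^sup>1 + a\<^sub>1 u\<^sup>2\<close> and
  \<open>w = u\<^sup>2\<close> are the first two members of the dual basis, so that \<open>v (x\<^sup>2\<^sup>n p i)\<close> and \<open>w (x\<^sup>2\<^sup>n p i)\<close> are the
  entries of the first two columns of \<open>J\<^sup>n\<close>. Each of (b), (c), (e) says that \<open>v\<close> and \<open>w\<close> obey a linear
  evolution law on all monomials. If \<open>r = 0\<close>, the law follows by induction on the degree from
  \<open>v (p i) = w (p i) = 0\<close> for \<open>i \<ge> 3\<close>. Conversely, the law makes all functionals \<open>v (x\<^sup>2\<^sup>k _)\<close> and
  \<open>w (x\<^sup>2\<^sup>k _)\<close> with \<open>2k + 1 < i\<close> and \<open>2k + 2 < i\<close>, respectively, vanish at \<open>r i\<close>; since these are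
  triangular with respect to \<open>p\<close> with products of the \<open>d\<^sub>n\<close> on the diagonal, \<open>r i = 0\<close>.

  For (d), the moments are \<open>O(\<parallel>J\<parallel>\<^sup>n)\<close> uniformly in \<open>t\<close>, so (c) can be summed. In the other direction,
  nothing is known about the size of the derivatives of the moments; one therefore integrates the right-hand
  sides of (c) in \<open>t\<close>, and the uniqueness of Laurent coefficients identifies the results with the moments.
\<close>

section \<open>Derivatives of vector-valued paths, uniqueness of power series, 2 by 2
  matrices\<close>

lemma has_vector_derivative_vec_iff:
  fixes f :: "real \<Rightarrow> 'a::real_normed_vector ^ 'n"
  shows "(f has_vector_derivative D) (at t) \<longleftrightarrow>
    (\<forall>i. ((\<lambda>s. f s $ i) has_vector_derivative D $ i) (at t))"
proof
  assume "(f has_vector_derivative D) (at t)"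
  then show "\<forall>i. ((\<lambda>s. f s $ i) has_vector_derivative D $ i) (at t)"
    by (auto intro: bounded_linear.has_vector_derivative [OF bounded_linear_vec_nth])
next
  assume *: "\<forall>i. ((\<lambda>s. f s $ i) has_vector_derivative D $ i) (at t)"
  show "(f has_vector_derivative D) (at t)"
    unfolding has_vector_derivative_def has_derivative_at
  proof (intro conjI bounded_linear_scaleR_left)
    show "(\<lambda>h. norm (f (t + h) - f t - h *\<^sub>R D) / norm h) \<midarrow>0\<rightarrow> 0"
    proof (rule tendsto_sandwich [where f = "\<lambda>h. 0"])
      show "\<forall>\<^sub>F h in at 0. norm (f (t + h) - f t - h *\<^sub>R D) / norm h \<le>
          (\<Sum>i\<in>UNIV. norm (f (t + h) $ i - f t $ i - h *\<^sub>R D $ i) / norm h)"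
      proof (rule always_eventually, rule allI)
        fix h
        show "norm (f (t + h) - f t - h *\<^sub>R D) / norm h \<le>
          (\<Sum>i\<in>UNIV. norm (f (t + h) $ i - f t $ i - h *\<^sub>R D $ i) / norm h)"
          using L2_set_le_sum [of UNIV "\<lambda>i. norm ((f (t + h) - f t - h *\<^sub>R D) $ i)"]
          unfolding sum_divide_distrib [symmetric] norm_vec_def
          by (intro divide_right_mono) auto
      qed
      have "(\<lambda>h. \<Sum>i\<in>UNIV. norm (f (t + h) $ i - f t $ i - h *\<^sub>R D $ i) / norm h) \<midarrow>0\<rightarrow> (\<Sum>i\<in>(UNIV::'n set). 0)"
        using * unfolding has_vector_derivative_def has_derivative_at
        by (intro tendsto_sum) auto
      then show "(\<lambda>h. \<Sum>i\<in>UNIV. norm (f (t + h) $ i - f t $ i - h *\<^sub>R D $ i) / norm h) \<midarrow>0\<rightarrow> 0"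
        by simp
    qed auto
  qed
qed

text \<open>Condition (e) states its derivative as a limit of difference quotients, the other
  conditions use \<open>has_vector_derivative\<close>; this connects the two.\<close>

lemma has_vector_derivative_iff_quotient:
  fixes f :: "real \<Rightarrow> 'a::real_normed_vector"
  shows "(f has_vector_derivative D) (at t) \<longleftrightarrow> (\<lambda>h. (f (t + h) - f t) /\<^sub>R h) \<midarrow>0\<rightarrow> D"
proof -
  have "(f has_vector_derivative D) (at t) \<longleftrightarrow>
      (\<lambda>h. norm (f (t + h) - f t - h *\<^sub>R D) / norm h) \<midarrow>0\<rightarrow> 0"
    unfolding has_vector_derivative_def has_derivative_at
    by (auto intro: bounded_linear_scaleR_left)
  also have "\<dots> \<longleftrightarrow> (\<lambda>h. norm ((f (t + h) - f t) /\<^sub>R h - D)) \<midarrow>0\<rightarrow> 0"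
  proof (rule filterlim_cong [OF refl refl])
    have "norm (f (t + h) - f t - h *\<^sub>R D) / norm h = norm ((f (t + h) - f t) /\<^sub>R h - D)" if "h \<noteq> 0" for h
    proof -
      have "(f (t + h) - f t) /\<^sub>R h - D = (f (t + h) - f t - h *\<^sub>R D) /\<^sub>R h"
        using that by (simp add: scaleR_diff_right)
      then show ?thesis by (simp add: divide_inverse_commute)
    qed
    then show "\<forall>\<^sub>F h in at 0. norm (f (t + h) - f t - h *\<^sub>R D) / norm h
        = norm ((f (t + h) - f t) /\<^sub>R h - D)"
      by (simp add: eventually_at_filter)
  qed
  also have "\<dots> \<longleftrightarrow> (\<lambda>h. (f (t + h) - f t) /\<^sub>R h) \<midarrow>0\<rightarrow> D"
    by (simp add: tendsto_norm_zero_iff LIM_zero_iff)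
  finally show ?thesis .
qed

text \<open>Once the lower coefficients vanish, division by \<open>y ^ n\<close> leaves a power
  series that is zero on a punctured disc, and its limit at 0 is \<open>w n\<close>. The point 0 is
  left out because \<open>y\<close> will be \<open>1 / z\<close>.\<close>

lemma powser_coeffs_zero:
  fixes w :: "nat \<Rightarrow> complex"
  assumes "0 < r" and sums: "\<And>y. y \<noteq> 0 \<Longrightarrow> norm y < r \<Longrightarrow> (\<lambda>n. w n * y ^ n) sums 0"
  shows "w n = 0"
proof (induction n rule: less_induct)
  case (less n)
  have "((\<lambda>y :: complex. 0 :: complex) \<longlongrightarrow> w (0 + n)) (at 0)"
  proof (rule powser_limit_0_strong [OF \<open>0 < r\<close>, where a = "\<lambda>k. w (k + n)"])
    fix y :: complex
    assume y: "y \<noteq> 0" "norm y < r"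
    have "(\<lambda>k. w (k + n) * y ^ (k + n)) sums (0 - (\<Sum>k<n. w k * y ^ k))"
      using sums [OF y] by (rule sums_split_initial_segment)
    also have "(\<Sum>k<n. w k * y ^ k) = 0"
      using less.IH by simp
    finally have "(\<lambda>k. w (k + n) * y ^ (k + n) / y ^ n) sums ((0 - 0) / y ^ n)"
      by (rule sums_divide)
    then show "(\<lambda>k. w (k + n) * y ^ k) sums 0"
      using y by (simp add: power_add)
  qed
  then show ?case
    using LIM_const_eq by force
qed

lemma mat2_mult:
  fixes x y :: "'a::comm_semiring_1"
  shows "mat2 x y z w ** mat2 x' y' z' w' =
     mat2 (x * x' + y * z') (x * y' + y * w') (z * x' + w * z') (z * y' + w * w')"
  by (simp add: mat2_def matrix_matrix_mult_def vec_eq_iff forall_2 sum_2)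

lemma mat2_cong: "x = x' \<Longrightarrow> y = y' \<Longrightarrow> z = z' \<Longrightarrow> w = w' \<Longrightarrow> mat2 x y z w = mat2 x' y' z' w'"
  by simp

lemma mat2_add:
  fixes x y :: "'a::comm_monoid_add"
  shows "mat2 x y z w + mat2 x' y' z' w' = mat2 (x + x') (y + y') (z + z') (w + w')"
  by (simp add: mat2_def vec_eq_iff forall_2)

lemma mat2_diff:
  fixes x y :: "'a::ab_group_add"
  shows "mat2 x y z w - mat2 x' y' z' w' = mat2 (x - x') (y - y') (z - z') (w - w')"
  by (simp add: mat2_def vec_eq_iff forall_2)

lemma has_vector_derivative_mat2_iff:
  fixes f g h k :: "real \<Rightarrow> complex"
  shows "((\<lambda>s. mat2 (f s) (g s) (h s) (k s)) has_vector_derivative mat2 x y z w) (at t) \<longleftrightarrow>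
    (f has_vector_derivative x) (at t) \<and> (g has_vector_derivative y) (at t) \<and>
    (h has_vector_derivative z) (at t) \<and> (k has_vector_derivative w) (at t)"
  by (simp add: has_vector_derivative_vec_iff forall_2 mat2_def)

lemma nat3_cases:
  fixes i :: nat
  obtains "i = 0" | "i = 1" | "i = 2" | n where "i = Suc (Suc (Suc n))"
proof (cases "i < 3")
  case True
  then have "i = 0 \<or> i = 1 \<or> i = 2" by auto
  then show ?thesis using that by blast
next
  case False
  then have "i = Suc (Suc (Suc (i - 3)))" by simp
  then show ?thesis by (rule that)
qed

lemma all_nat_parity: "(\<forall>i\<ge>1. P i) \<longleftrightarrow> (\<forall>m. P (2 * m + 1) \<and> P (2 * m + 2))" for P :: "nat \<Rightarrow> bool"
proof
  assume *: "\<forall>m. P (2 * m + 1) \<and> P (2 * m + 2)"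
  show "\<forall>i\<ge>1. P i"
  proof (intro allI impI)
    fix i :: nat
    assume "i \<ge> 1"
    then have "i = 2 * ((i - 1) div 2) + 1 \<or> i = 2 * ((i - 1) div 2) + 2" by presburger
    then show "P i" using * by metis
  qed
qed auto

section \<open>Paths of polynomials\<close>

text \<open>The derivative is taken coefficientwise. The degree bound, uniform in time, makes
  evaluation at a point a finite sum of fixed length, which can then be differentiated as
  well.\<close>

definition has_poly_derivative :: "(real \<Rightarrow> complex poly) \<Rightarrow> complex poly \<Rightarrow> real \<Rightarrow> bool" where
  "has_poly_derivative Q Q' t \<longleftrightarrow> (\<exists>N. \<forall>s. degree (Q s) \<le> N) \<and>
     (\<forall>k. ((\<lambda>s. coeff (Q s) k) has_vector_derivative coeff Q' k) (at t))"

lemma has_poly_derivative_unique: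
  assumes "has_poly_derivative Q P t" "has_poly_derivative Q R t"
  shows "P = R"
proof (rule poly_eqI)
  fix k
  show "coeff P k = coeff R k"
    using assms vector_derivative_unique_at unfolding has_poly_derivative_def by blast
qed

lemma has_poly_derivative_const: "has_poly_derivative (\<lambda>s. P) 0 t"
  by (auto simp: has_poly_derivative_def)

lemma has_poly_derivative_add:
  assumes "has_poly_derivative P P' t" "has_poly_derivative Q Q' t"
  shows "has_poly_derivative (\<lambda>s. P s + Q s) (P' + Q') t"
proof -
  obtain M N where "\<And>s. degree (P s) \<le> M" "\<And>s. degree (Q s) \<le> N"
    using assms unfolding has_poly_derivative_def by blast
  then have "\<And>s. degree (P s + Q s) \<le> max M N"
    by (meson degree_add_le max.coboundedI1 max.coboundedI2)
  then show ?thesis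
    using assms by (auto simp: has_poly_derivative_def intro!: has_vector_derivative_add)
qed

lemma has_poly_derivative_smult:
  assumes "(f has_vector_derivative f') (at t)" "has_poly_derivative P P' t"
  shows "has_poly_derivative (\<lambda>s. smult (f s) (P s)) (smult f' (P t) + smult (f t) P') t"
proof -
  obtain N where N: "\<And>s. degree (P s) \<le> N"
    using assms unfolding has_poly_derivative_def by blast
  have "((\<lambda>s. f s * coeff (P s) k) has_vector_derivative f t * coeff P' k + f' * coeff (P t) k) (at t)" for k
    using assms by (intro has_vector_derivative_mult) (auto simp: has_poly_derivative_def)
  moreover have "\<And>s. degree (smult (f s) (P s)) \<le> N"
    using N degree_smult_le order_trans by blast
  ultimately show ?thesis
    unfolding has_poly_derivative_def coeff_add coeff_smult add.commute [of "f' * _"] by blast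
qed

lemma has_poly_derivative_smult_const:
  assumes "has_poly_derivative P P' t"
  shows "has_poly_derivative (\<lambda>s. smult z (P s)) (smult z P') t"
  using has_poly_derivative_smult [OF has_vector_derivative_const assms, of z] by simp

lemma has_poly_derivative_diff:
  assumes "has_poly_derivative P P' t" "has_poly_derivative Q Q' t"
  shows "has_poly_derivative (\<lambda>s. P s - Q s) (P' - Q') t"
  using has_poly_derivative_add [OF assms(1) has_poly_derivative_smult_const [OF assms(2), of "-1"]]
  by simp

lemma has_poly_derivative_monom_mult:
  assumes "has_poly_derivative P P' t"
  shows "has_poly_derivative (\<lambda>s. monom 1 n * P s) (monom 1 n * P') t"
proof -
  obtain N where N: "\<And>s. degree (P s) \<le> N"
    using assms unfolding has_poly_derivative_def by blast
  have "degree (monom 1 n * P s) \<le> n + N" for s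
    using N [of s] by (metis add_mono degree_monom_le degree_mult_le order_trans)
  then show ?thesis
    using assms by (auto simp: has_poly_derivative_def coeff_monom_mult)
qed

lemmas has_poly_derivative_intros =
  has_poly_derivative_const has_poly_derivative_add has_poly_derivative_diff
  has_poly_derivative_smult has_poly_derivative_monom_mult

lemma poly_as_sum_upto:
  fixes P :: "complex poly"
  assumes "degree P \<le> N"
  shows "poly P x = (\<Sum>k\<le>N. coeff P k * x ^ k)"
  using assms by (simp add: poly_altdef sum.mono_neutral_left coeff_eq_0)

lemma has_poly_derivative_poly:
  assumes "has_poly_derivative P P' t"
  shows "((\<lambda>s. poly (P s) x) has_vector_derivative poly P' x) (at t)"
proof -
  obtain N where N: "\<And>s. degree (P s) \<le> N"
    using assms unfolding has_poly_derivative_def by blast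
  define M where "M = max N (degree P')"
  have "((\<lambda>s. \<Sum>k\<le>M. coeff (P s) k * x ^ k) has_vector_derivative (\<Sum>k\<le>M. coeff P' k * x ^ k)) (at t)"
    using assms by (intro has_vector_derivative_sum has_vector_derivative_mult_left)
      (auto simp: has_poly_derivative_def)
  moreover have "\<And>s. degree (P s) \<le> M" "degree P' \<le> M"
    using N by (auto simp: M_def le_max_iff_disj)
  ultimately show ?thesis
    by (simp only: poly_as_sum_upto [of _ M])
qed

section \<open>Linear functionals on polynomials\<close>

definition plinear :: "(complex poly \<Rightarrow> complex) \<Rightarrow> bool" where
  "plinear \<phi> \<longleftrightarrow> (\<forall>P Q. \<phi> (P + Q) = \<phi> P + \<phi> Q) \<and> (\<forall>z P. \<phi> (smult z P) = z * \<phi> P)"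

lemma linear_functionals_plinear: "linear_functionals U \<Longrightarrow> plinear (U $ j)"
  unfolding linear_functionals_def plinear_def Vector_Spaces.linear_iff by blast

lemma plinear_add: "plinear \<phi> \<Longrightarrow> \<phi> (P + Q) = \<phi> P + \<phi> Q"
  by (simp add: plinear_def)

lemma plinear_smult: "plinear \<phi> \<Longrightarrow> \<phi> (smult z P) = z * \<phi> P"
  by (simp add: plinear_def)

lemma plinear_0: "plinear \<phi> \<Longrightarrow> \<phi> 0 = 0"
  using plinear_smult [of \<phi> 0 0] by simp

lemma plinear_minus: "plinear \<phi> \<Longrightarrow> \<phi> (- P) = - \<phi> P"
  using plinear_smult [of \<phi> "-1" P] by simp

lemma plinear_diff: "plinear \<phi> \<Longrightarrow> \<phi> (P - Q) = \<phi> P - \<phi> Q"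
  by (simp only: diff_conv_add_uminus plinear_add plinear_minus)

lemma plinear_sum: "plinear \<phi> \<Longrightarrow> \<phi> (\<Sum>i\<in>S. f i) = (\<Sum>i\<in>S. \<phi> (f i))"
  by (induction S rule: infinite_finite_induct) (auto simp: plinear_0 plinear_add)

lemmas plinear_simps = plinear_add plinear_diff plinear_minus plinear_smult plinear_0 plinear_sum

lemma plinear_expand:
  assumes "plinear \<phi>" "\<And>k. n \<le> k \<Longrightarrow> coeff P k = 0"
  shows "\<phi> P = (\<Sum>k<n. coeff P k * \<phi> (monom 1 k))"
proof -
  have "P = (\<Sum>k<n. smult (coeff P k) (monom 1 k))"
    using assms(2) by (auto simp: poly_eq_iff coeff_sum coeff_monom not_less if_distrib sum.delta cong: if_cong)
  then show ?thesis
    by (metis (no_types, lifting) assms(1) plinear_smult plinear_sum sum.cong)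
qed

text \<open>The product rule for the pairing of a moving functional with a moving polynomial. Here
  \<open>\<delta>\<close> stands for the derivative of \<open>\<phi>\<close> at \<open>t\<close>; it
  is tied to \<open>\<phi>\<close> on monomials of degree below \<open>n\<close>, which suits
  inductions on the degree.\<close>

lemma plinear_path_derivative:
  assumes lin: "\<And>s. plinear (\<phi> s)" and \<delta>: "plinear \<delta>"
    and mono: "\<And>k. k < n \<Longrightarrow>
      ((\<lambda>s. \<phi> s (monom 1 k)) has_vector_derivative \<delta> (monom 1 k)) (at t)"
    and P: "has_poly_derivative P P' t" and deg: "\<And>s k. n \<le> k \<Longrightarrow> coeff (P s) k = 0"
  shows "((\<lambda>s. \<phi> s (P s)) has_vector_derivative \<delta> (P t) + \<phi> t P') (at t)"
proof -
  have coeff: "((\<lambda>s. coeff (P s) k) has_vector_derivative coeff P' k) (at t)" for k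
    using P by (simp add: has_poly_derivative_def)
  have deg': "coeff P' k = 0" if "n \<le> k" for k
    using coeff [of k] that by (simp add: deg vector_derivative_unique_at has_vector_derivative_const)
  have "((\<lambda>s. \<Sum>k<n. coeff (P s) k * \<phi> s (monom 1 k)) has_vector_derivative
      (\<Sum>k<n. coeff (P t) k * \<delta> (monom 1 k) + coeff P' k * \<phi> t (monom 1 k))) (at t)"
    using coeff mono by (intro has_vector_derivative_sum has_vector_derivative_mult) auto
  then show ?thesis
    using plinear_expand [OF lin deg] plinear_expand [OF lin deg'] plinear_expand [OF \<delta> deg]
    by (simp add: sum.distrib)
qed

section \<open>The scalar polynomials\<close>

text \<open>Row \<open>n + 1\<close> of \<open>x^2 p = J p\<close>, solved for the term of highest
  index. The value 0 at index 0 removes the terms that would lie to the left of the matrix.\<close>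

fun opoly :: "cseq \<Rightarrow> cseq \<Rightarrow> cseq \<Rightarrow> cseq \<Rightarrow> nat \<Rightarrow> complex poly" where
  "opoly a b c d 0 = 0"
| "opoly a b c d (Suc 0) = 1"
| "opoly a b c d (Suc (Suc 0)) = [:- a 1, 1:]"
| "opoly a b c d (Suc (Suc (Suc n))) =
     monom 1 2 * opoly a b c d (Suc n) - smult (a (n + 2)) (opoly a b c d (Suc (Suc n)))
     - smult (b (n + 1)) (opoly a b c d (Suc n)) - smult (c n) (opoly a b c d n)
     - smult (d (n - 1)) (opoly a b c d (n - 1))"

lemma opoly_rec:
  assumes "i \<ge> 1"
  shows "monom 1 2 * opoly a b c d i = opoly a b c d (i + 2)
    + smult (a (i + 1)) (opoly a b c d (i + 1)) + smult (b i) (opoly a b c d i)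
    + smult (c (i - 1)) (opoly a b c d (i - 1)) + smult (d (i - 2)) (opoly a b c d (i - 2))"
  using assms by (cases i) simp_all

lemma coeff_opoly_ge: "i \<le> k \<Longrightarrow> coeff (opoly a b c d i) k = 0"
proof (induction a b c d i arbitrary: k rule: opoly.induct)
  case (3 a b c d)
  then show ?case by (auto simp: coeff_pCons split: nat.splits)
qed (auto simp: coeff_monom_mult)

lemma coeff_opoly_lead: "coeff (opoly a b c d (Suc i)) i = 1"
proof (induction a b c d "Suc i" arbitrary: i rule: opoly.induct)
  case (3 a b c d)
  then show ?case by (auto simp: numeral_2_eq_2)
qed (auto simp: coeff_monom_mult coeff_opoly_ge)

text \<open>There is one monic polynomial for each degree below \<open>n\<close>, so leading terms
  can be subtracted one by one.\<close>

lemma opoly_span: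
  assumes "\<And>k. n \<le> k \<Longrightarrow> coeff P k = 0"
  shows "\<exists>e. P = (\<Sum>l=1..n. smult (e l) (opoly a b c d l))"
  using assms
proof (induction n arbitrary: P)
  case 0
  then show ?case by (simp add: poly_eq_iff)
next
  case (Suc n)
  define Q where "Q = P - smult (coeff P n) (opoly a b c d (Suc n))"
  have "coeff Q k = 0" if "n \<le> k" for k
    using Suc.prems [of k] that coeff_opoly_lead [of a b c d n] coeff_opoly_ge [of "Suc n" k a b c d]
    by (cases "k = n") (auto simp: Q_def)
  then obtain e where e: "Q = (\<Sum>l=1..n. smult (e l) (opoly a b c d l))"
    using Suc.IH by blast
  have "P = Q + smult (coeff P n) (opoly a b c d (Suc n))"
    by (simp add: Q_def)
  also have "\<dots> = (\<Sum>l=1..Suc n. smult ((e(Suc n := coeff P n)) l) (opoly a b c d l))"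
    by (simp add: e)
  finally show ?case by blast
qed

text \<open>The two rows of the block recurrence are scalar recurrences of odd and even index. In
  the second row \<open>Ablk\<close> brings in the first entry of the new vector, so the first entry
  is identified before the second.\<close>

lemma Bvec_opoly:
  assumes "c 0 = 0" "d 0 = 0"
  shows "Bvec a b c d m $ 1 = opoly a b c d (2 * m + 1) \<and> Bvec a b c d m $ 2 = opoly a b c d (2 * m + 2)"
proof (induction m rule: less_induct)
  case (less m)
  show ?case
  proof (cases m)
    case 0
    then show ?thesis by simp
  next
    case (Suc n)
    have IH: "Bvec a b c d n $ 1 = opoly a b c d (2 * n + 1)" "Bvec a b c d n $ 2 = opoly a b c d (2 * n + 2)"
      using less [of n] Suc by auto
    have IH': "smult z (prev (Bvec a b c d) n $ 1) = smult z (opoly a b c d (2 * n - 1))"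
      "smult z (prev (Bvec a b c d) n $ 2) = smult z (opoly a b c d (2 * n))" for z
      using less [of "n - 1"] Suc by (auto simp: prev_def split: nat.splits)
    have row1: "monom 1 2 * Bvec a b c d n $ 1 = Bvec a b c d m $ 1
        + smult (b (2*n+1)) (Bvec a b c d n $ 1) + smult (a (2*n+2)) (Bvec a b c d n $ 2)
        + smult (d (2*n-1)) (opoly a b c d (2 * n - 1)) + smult (c (2*n)) (opoly a b c d (2 * n))"
      using arg_cong [OF Bvec_recurrence [of a b c d n], of "\<lambda>v. v $ 1"]
      by (simp add: const_mat_def map_matrix_def matrix_vector_mult_def sum_2 Ablk_def Bblk_def
        Cblk_def mat2_def Suc IH' algebra_simps)
    have row2: "monom 1 2 * Bvec a b c d n $ 2 = Bvec a b c d m $ 2 + smult (a (2*n+3)) (Bvec a b c d m $ 1)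
        + smult (c (2*n+1)) (Bvec a b c d n $ 1) + smult (b (2*n+2)) (Bvec a b c d n $ 2)
        + smult (d (2*n)) (opoly a b c d (2 * n))"
      using arg_cong [OF Bvec_recurrence [of a b c d n], of "\<lambda>v. v $ 2"]
      by (simp add: const_mat_def map_matrix_def matrix_vector_mult_def sum_2 Ablk_def Bblk_def
        Cblk_def mat2_def Suc IH' algebra_simps)
    have 1: "Bvec a b c d m $ 1 = opoly a b c d (2 * m + 1)"
      using row1 opoly_rec [of "2*n+1" a b c d] by (simp add: IH Suc numeral_3_eq_3 algebra_simps)
    moreover have "Bvec a b c d m $ 2 = opoly a b c d (2 * m + 2)"
      using row2 opoly_rec [of "2*n+2" a b c d] unfolding 1
      by (simp add: IH Suc numeral_3_eq_3 algebra_simps)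
    ultimately show ?thesis by blast
  qed
qed

text \<open>The truncated indices are harmless, as \<open>c 0 = d 0 = 0\<close> in all applications.\<close>

definition strict_lower :: "cseq \<Rightarrow> cseq \<Rightarrow> (nat \<Rightarrow> complex poly) \<Rightarrow> nat \<Rightarrow> complex poly" where
  "strict_lower c d p i = smult (c (i - 1)) (p (i - 1)) + smult (d (i - 2)) (p (i - 2))"

section \<open>Even and odd parts, the entries of \<open>Vmat\<close>\<close>

definition even_part :: "complex poly \<Rightarrow> complex poly" where
  "even_part P = (\<Sum>k\<le>degree P. monom (coeff P (2 * k)) k)"

definition odd_part :: "complex poly \<Rightarrow> complex poly" where
  "odd_part P = (\<Sum>k\<le>degree P. monom (coeff P (Suc (2 * k))) k)"

lemma coeff_even_part: "coeff (even_part P) k = coeff P (2 * k)"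
  by (auto simp: even_part_def coeff_sum coeff_monom coeff_eq_0)

lemma coeff_odd_part: "coeff (odd_part P) k = coeff P (Suc (2 * k))"
  by (auto simp: odd_part_def coeff_sum coeff_monom coeff_eq_0)

lemma even_odd_part_eqI:
  assumes "even_part P = even_part Q" "odd_part P = odd_part Q"
  shows "P = Q"
proof (rule poly_eqI)
  fix n
  show "coeff P n = coeff Q n"
  proof (cases "even n")
    case True
    then obtain k where "n = 2 * k" by blast
    then show ?thesis using arg_cong [OF assms(1), of "\<lambda>p. coeff p k"] by (simp add: coeff_even_part)
  next
    case False
    then obtain k where "n = Suc (2 * k)" by (auto elim: oddE)
    then show ?thesis using arg_cong [OF assms(2), of "\<lambda>p. coeff p k"] by (simp add: coeff_odd_part)
  qed
qed

lemma even_part_linear: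
  "even_part (- P) = - even_part P" "even_part (P + Q) = even_part P + even_part Q"
  "even_part (P - Q) = even_part P - even_part Q"
  "even_part (smult z P) = smult z (even_part P)" "even_part 0 = 0"
  by (simp_all add: poly_eq_iff coeff_even_part)

lemma odd_part_linear:
  "odd_part (- P) = - odd_part P" "odd_part (P + Q) = odd_part P + odd_part Q"
  "odd_part (P - Q) = odd_part P - odd_part Q"
  "odd_part (smult z P) = smult z (odd_part P)" "odd_part 0 = 0"
  by (simp_all add: poly_eq_iff coeff_odd_part)

text \<open>Comparing coefficients of even and of odd degree in \<open>B = q(x^2) + x r(x^2)\<close>
  replaces the definite description in \<open>Vmat\<close> by an explicit formula.\<close>

lemma Vmat_parts:
  "Vmat a b c d m $ i $ 1 = even_part (Bvec a b c d m $ i)"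
  "Vmat a b c d m $ i $ 2 = odd_part (Bvec a b c d m $ i)"
proof -
  have B: "Bvec a b c d m $ i = (Vmat a b c d m $ i $ 1) \<circ>\<^sub>p monom 1 2
      + [:0, 1:] * ((Vmat a b c d m $ i $ 2) \<circ>\<^sub>p monom 1 2)"
    using arg_cong [OF Vmat [of a b c d m], of "\<lambda>v. v $ i"]
    by (simp add: at_square_def map_matrix_def matrix_vector_mult_def sum_2 Pvec0_def algebra_simps)
  have "coeff (Bvec a b c d m $ i) (2 * k) = coeff (Vmat a b c d m $ i $ 1) k" for k
    unfolding B by (cases k) (simp_all add: coeff_pcompose_square poly_0_coeff_0)
  then show "Vmat a b c d m $ i $ 1 = even_part (Bvec a b c d m $ i)"
    by (simp add: poly_eq_iff coeff_even_part)
  have "coeff (Bvec a b c d m $ i) (Suc (2 * k)) = coeff (Vmat a b c d m $ i $ 2) k" for k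
    unfolding B by (simp add: coeff_pcompose_square)
  then show "Vmat a b c d m $ i $ 2 = odd_part (Bvec a b c d m $ i)"
    by (simp add: poly_eq_iff coeff_odd_part)
qed

lemma has_poly_derivative_even_part:
  assumes "has_poly_derivative P P' t"
  shows "has_poly_derivative (\<lambda>s. even_part (P s)) (even_part P') t"
proof -
  obtain N where N: "\<And>s. degree (P s) \<le> N"
    using assms unfolding has_poly_derivative_def by blast
  have "degree (even_part (P s)) \<le> N" for s
  proof (rule degree_le)
    show "\<forall>i>N. coeff (even_part (P s)) i = 0"
      using N [of s] by (simp add: coeff_even_part coeff_eq_0)
  qed
  then show ?thesis
    using assms by (auto simp: has_poly_derivative_def coeff_even_part)
qed

lemma has_poly_derivative_odd_part:
  assumes "has_poly_derivative P P' t"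
  shows "has_poly_derivative (\<lambda>s. odd_part (P s)) (odd_part P') t"
proof -
  obtain N where N: "\<And>s. degree (P s) \<le> N"
    using assms unfolding has_poly_derivative_def by blast
  have "degree (odd_part (P s)) \<le> N" for s
  proof (rule degree_le)
    show "\<forall>i>N. coeff (odd_part (P s)) i = 0"
      using N [of s] by (simp add: coeff_odd_part coeff_eq_0)
  qed
  then show ?thesis
    using assms by (auto simp: has_poly_derivative_def coeff_odd_part)
qed

text \<open>Polynomials that agree at every complex point are equal, so the pointwise conditions (f)
  and (g) become identities between polynomials.\<close>

lemma has_poly_derivative_poly_iff:
  assumes "has_poly_derivative P P' t"
  shows "(\<forall>x. ((\<lambda>s. poly (P s) x) has_vector_derivative poly Q x) (at t)) \<longleftrightarrow> P' = Q"
proof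
  assume "\<forall>x. ((\<lambda>s. poly (P s) x) has_vector_derivative poly Q x) (at t)"
  then have "poly P' x = poly Q x" for x
    using has_poly_derivative_poly [OF assms] vector_derivative_unique_at by blast
  then show "P' = Q" by (simp add: poly_eq_poly_eq_iff [symmetric] fun_eq_iff)
next
  show "P' = Q \<Longrightarrow> \<forall>x. ((\<lambda>s. poly (P s) x) has_vector_derivative poly Q x) (at t)"
    using has_poly_derivative_poly [OF assms] by simp
qed

section \<open>Differentiable families of coefficients\<close>

text \<open>The derivatives are parameters, which turns the differential equations into algebraic
  ones. \<open>a1\<close> is the hypothesis that the derivative of \<open>a 1\<close> is
  \<open>c 1\<close>.\<close>

locale flow =
  fixes a b c d a' b' c' d' :: tseq
  assumes a': "((\<lambda>s. a s n) has_vector_derivative a' t n) (at t)"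
    and b': "((\<lambda>s. b s n) has_vector_derivative b' t n) (at t)"
    and c': "((\<lambda>s. c s n) has_vector_derivative c' t n) (at t)"
    and d': "((\<lambda>s. d s n) has_vector_derivative d' t n) (at t)"
    and c0 [simp]: "c t 0 = 0" and d0 [simp]: "d t 0 = 0"
    and a1: "a' t 1 = c t 1"
begin

definition p :: "real \<Rightarrow> nat \<Rightarrow> complex poly" where
  "p t = opoly (a t) (b t) (c t) (d t)"

lemma p_simps [simp]: "p t 0 = 0" "p t (Suc 0) = 1" "p t 1 = 1" "p t 2 = [:- a t 1, 1:]"
  by (simp_all add: p_def numeral_2_eq_2)

lemma p_rec:
  "i \<ge> 1 \<Longrightarrow> monom 1 2 * p t i = p t (i + 2) + smult (a t (i + 1)) (p t (i + 1)) + smult (b t i) (p t i)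
    + strict_lower (c t) (d t) (p t) i"
  by (simp add: p_def strict_lower_def opoly_rec)

lemma p_derivative_exists: "\<exists>Q. has_poly_derivative (\<lambda>s. p s i) Q t"
proof (induction i rule: less_induct)
  case (less i)
  consider "i = 0" | "i = 1" | "i = 2" | n where "i = Suc (Suc (Suc n))"
    by (rule nat3_cases)
  then show ?case
  proof cases
    case 3
    have "p s 2 = monom 1 1 - smult (a s 1) 1" for s
      by (simp add: monom_altdef)
    \<comment> \<open>The derivative is left as a schematic variable, which the introduction rules
      fill in.\<close>
    moreover have "\<exists>Q. has_poly_derivative (\<lambda>s. monom 1 1 - smult (a s 1) 1) Q t"
      by (rule exI has_poly_derivative_intros a')+
    ultimately show ?thesis
      using 3 by simp
  next
    case 4
    obtain Q where "\<And>k. k < i \<Longrightarrow> has_poly_derivative (\<lambda>s. p s k) (Q k) t"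
      using less by metis
    then have Q: "has_poly_derivative (\<lambda>s. p s (Suc (Suc n))) (Q (Suc (Suc n))) t"
      "has_poly_derivative (\<lambda>s. p s (Suc n)) (Q (Suc n)) t"
      "has_poly_derivative (\<lambda>s. p s n) (Q n) t"
      "has_poly_derivative (\<lambda>s. p s (n - 1)) (Q (n - 1)) t"
      using 4 by auto
    show ?thesis
      unfolding 4 p_def opoly.simps unfolding p_def [symmetric]
      by (rule exI has_poly_derivative_intros Q a' b' c' d')+
  qed (auto intro: has_poly_derivative_const)
qed

definition pdot :: "real \<Rightarrow> nat \<Rightarrow> complex poly" where
  "pdot t i = (SOME Q. has_poly_derivative (\<lambda>s. p s i) Q t)"

lemma pdot: "has_poly_derivative (\<lambda>s. p s i) (pdot t i) t"
  unfolding pdot_def by (rule someI_ex) (rule p_derivative_exists)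

lemma pdot_eqI: "has_poly_derivative (\<lambda>s. p s i) Q t \<Longrightarrow> pdot t i = Q"
  using pdot has_poly_derivative_unique by blast

lemma pdot_0 [simp]: "pdot t 0 = 0"
  by (rule pdot_eqI) (simp add: has_poly_derivative_const)

lemma pdot_1 [simp]: "pdot t (Suc 0) = 0"
  by (rule pdot_eqI) (simp add: has_poly_derivative_const)

text \<open>As \<open>p 2\<close> is \<open>x - a 1\<close>, the hypothesis on the derivative of
  \<open>a 1\<close> amounts to the vanishing at index 2 of the residual introduced below.\<close>

lemma pdot_2: "pdot t 2 = smult (- c t 1) 1"
proof (rule pdot_eqI)
  have "p s 2 = monom 1 1 - smult (a s 1) 1" for s
    by (simp add: monom_altdef)
  moreover have "has_poly_derivative (\<lambda>s. monom 1 1 - smult (a s 1) 1)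
      (0 - (smult (a' t 1) 1 + smult (a t 1) 0)) t"
    by (rule has_poly_derivative_intros a')+
  ultimately show "has_poly_derivative (\<lambda>s. p s 2) (smult (- c t 1) 1) t"
    by (simp add: a1 [simplified])
qed

text \<open>The leading coefficient of \<open>p i\<close>, at \<open>x^(i - 1)\<close>, is
  constantly 1, so differentiation in time lowers the degree. The residual inherits this degree
  bound.\<close>

lemma coeff_pdot: "i \<le> Suc k \<Longrightarrow> coeff (pdot t i) k = 0"
proof -
  assume "i \<le> Suc k"
  then have "\<exists>z. \<forall>s. coeff (p s i) k = z"
    using coeff_opoly_ge [of i k] coeff_opoly_lead [of _ _ _ _ k] unfolding p_def
    by (metis le_SucE)
  then obtain z where "\<And>s. coeff (p s i) k = z" by blast
  moreover have "((\<lambda>s. coeff (p s i) k) has_vector_derivative coeff (pdot t i) k) (at t)"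
    using pdot unfolding has_poly_derivative_def by blast
  ultimately show ?thesis
    using vector_derivative_unique_at has_vector_derivative_const by fastforce
qed

lemma pdot_rec:
  assumes "i \<ge> 1"
  shows "monom 1 2 * pdot t i = pdot t (i + 2)
    + (smult (a' t (i + 1)) (p t (i + 1)) + smult (a t (i + 1)) (pdot t (i + 1)))
    + (smult (b' t i) (p t i) + smult (b t i) (pdot t i))
    + ((smult (c' t (i - 1)) (p t (i - 1)) + smult (c t (i - 1)) (pdot t (i - 1)))
    + (smult (d' t (i - 2)) (p t (i - 2)) + smult (d t (i - 2)) (pdot t (i - 2))))"
proof (rule has_poly_derivative_unique)
  show "has_poly_derivative (\<lambda>s. monom 1 2 * p s i) (monom 1 2 * pdot t i) t"
    by (rule has_poly_derivative_monom_mult pdot)+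
  show "has_poly_derivative (\<lambda>s. monom 1 2 * p s i) (pdot t (i + 2)
    + (smult (a' t (i + 1)) (p t (i + 1)) + smult (a t (i + 1)) (pdot t (i + 1)))
    + (smult (b' t i) (p t i) + smult (b t i) (pdot t i))
    + ((smult (c' t (i - 1)) (p t (i - 1)) + smult (c t (i - 1)) (pdot t (i - 1)))
    + (smult (d' t (i - 2)) (p t (i - 2)) + smult (d t (i - 2)) (pdot t (i - 2))))) t"
    unfolding p_rec [OF assms] strict_lower_def
    by (rule has_poly_derivative_intros pdot a' b' c' d')+
qed

definition residual :: "real \<Rightarrow> nat \<Rightarrow> complex poly" where
  "residual t i = pdot t i + strict_lower (c t) (d t) (p t) i"

lemma residual_simps [simp]:
  "residual t 0 = 0" "residual t (Suc 0) = 0" "residual t 2 = 0"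
  using pdot_2 [of t] by (simp_all add: residual_def strict_lower_def numeral_2_eq_2)

text \<open>The four defects are the entries of \<open>J' - (J J\<^sub>- - J\<^sub>- J)\<close> in row \<open>i\<close>.\<close>

lemma residual_rec:
  assumes "i \<ge> 1"
  shows "monom 1 2 * residual t i - (residual t (i + 2) + smult (a t (i + 1)) (residual t (i + 1))
      + smult (b t i) (residual t i) + smult (c t (i - 1)) (residual t (i - 1))
      + smult (d t (i - 2)) (residual t (i - 2)))
    = smult (a' t (i + 1) - (c t (i + 1) - c t (i - 1))) (p t (i + 1))
    + smult (b' t i - (c t i * a t (i + 1) - c t (i - 1) * a t i + d t i - d t (i - 2))) (p t i)
    + smult (c' t (i - 1) - (c t (i - 1) * (b t i - b t (i - 1)) + d t (i - 1) * a t (i + 1)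
        - d t (i - 2) * a t (i - 1))) (p t (i - 1))
    + smult (d' t (i - 2) - d t (i - 2) * (b t i - b t (i - 2))) (p t (i - 2))"
proof -
  let ?X = "monom 1 2 :: complex poly"
  have X: "?X * residual t i = ?X * pdot t i + smult (c t (i - 1)) (?X * p t (i - 1))
      + smult (d t (i - 2)) (?X * p t (i - 2))"
    by (simp add: residual_def strict_lower_def distrib_left)
  \<comment> \<open>The recurrence at index \<open>i - 1\<close>; for \<open>i = 1\<close> both
    sides vanish because \<open>c 0 = 0\<close>. Likewise \<open>pd\<close> is the recurrence at
    \<open>i - 2\<close>, with \<open>d 0 = 0\<close> for \<open>i \<le> 2\<close>.\<close>
  have pc: "smult (c t (i - 1)) (?X * p t (i - 1)) = smult (c t (i - 1)) (p t (i + 1)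
      + smult (a t i) (p t i) + smult (b t (i - 1)) (p t (i - 1))
      + smult (c t (i - 2)) (p t (i - 2)) + smult (d t (i - 3)) (p t (i - 3)))"
  proof (cases "i = 1")
    case False
    then have "i - 1 \<ge> 1" "i - 1 + 2 = i + 1" "i - 1 + 1 = i" "i - 1 - 1 = i - 2" "i - 1 - 2 = i - 3"
      using assms by auto
    then show ?thesis
      using p_rec [of "i - 1" t] by (simp only: strict_lower_def add.assoc)
  qed simp
  have pd: "smult (d t (i - 2)) (?X * p t (i - 2)) = smult (d t (i - 2)) (p t i
      + smult (a t (i - 1)) (p t (i - 1)) + smult (b t (i - 2)) (p t (i - 2))
      + smult (c t (i - 3)) (p t (i - 3)) + smult (d t (i - 4)) (p t (i - 4)))"
  proof (cases "i < 3")
    case True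
    then have "i = 1 \<or> i = 2" using assms by auto
    then show ?thesis by auto
  next
    case False
    then have "i - 2 \<ge> 1" "i - 2 + 2 = i" "i - 2 + 1 = i - 1" "i - 2 - 1 = i - 3" "i - 2 - 2 = i - 4"
      by auto
    then show ?thesis
      using p_rec [of "i - 2" t] by (simp only: strict_lower_def add.assoc)
  qed
  have idx: "i + 2 - 1 = i + 1" "i + 2 - 2 = i" "i + 1 - 1 = i" "i + 1 - 2 = i - 1"
    "i - 1 - 1 = i - 2" "i - 1 - 2 = i - 3" "i - 2 - 1 = i - 3" "i - 2 - 2 = i - 4"
    using assms by auto
  \<comment> \<open>With every multiplication by \<open>x^2\<close> eliminated, only members of
    \<open>p\<close> and \<open>pdot\<close> remain, and the identity follows by collecting terms in
    each coefficient.\<close>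
  show ?thesis
    unfolding X [unfolded pdot_rec [OF assms] pc pd] unfolding residual_def strict_lower_def idx
    by (rule poly_eqI) (simp only: coeff_add coeff_diff coeff_smult, simp add: algebra_simps)
qed

section \<open>Condition (a) and the residual\<close>

lemma toda_iff:
  "toda_system a b c d \<longleftrightarrow> (\<forall>t. \<forall>n\<ge>1. a' t n = c t n - c t (n - 2) \<and>
     b' t n = c t n * a t (n + 1) - c t (n - 1) * a t n + d t n - d t (n - 2) \<and>
     c' t n = c t n * (b t (n + 1) - b t n) + d t n * a t (n + 2) - d t (n - 1) * a t n \<and>
     d' t n = d t n * (b t (n + 2) - b t n))"
proof -
  have "((\<lambda>s. a s n) has_vector_derivative D) (at t) \<longleftrightarrow> a' t n = D"
    "((\<lambda>s. b s n) has_vector_derivative D) (at t) \<longleftrightarrow> b' t n = D"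
    "((\<lambda>s. c s n) has_vector_derivative D) (at t) \<longleftrightarrow> c' t n = D"
    "((\<lambda>s. d s n) has_vector_derivative D) (at t) \<longleftrightarrow> d' t n = D" for n t D
    using a' b' c' d' vector_derivative_unique_at by blast+
  then show ?thesis
    unfolding toda_system_def by simp
qed

text \<open>When the four defects vanish, \<open>residual_rec\<close> expresses
  \<open>residual t (n + 2)\<close> through residuals of smaller index, and the first three of these
  are zero.\<close>

lemma residual_zero_if_toda:
  assumes "toda_system a b c d"
  shows "residual t i = 0"
proof (induction i rule: less_induct)
  case (less i)
  show ?case
  proof (cases "i < 3")
    case True
    then have "i = 0 \<or> i = 1 \<or> i = 2" by auto
    then show ?thesis by auto
  next
    case False
    define n where "n = i - 2"
    have n: "i = n + 2" "n \<ge> 1" using False by (auto simp: n_def)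
    have IH: "residual t (n + 1) = 0" "residual t n = 0" "residual t (n - 1) = 0" "residual t (n - 2) = 0"
      using less n by auto
    have ab: "a' t (n + 1) - (c t (n + 1) - c t (n - 1)) = 0"
      "b' t n - (c t n * a t (n + 1) - c t (n - 1) * a t n + d t n - d t (n - 2)) = 0"
      using assms n unfolding toda_iff by auto
    \<comment> \<open>For \<open>n = 1\<close> this defect belongs to index 0, where the system says
      nothing, but it multiplies \<open>p 0 = 0\<close>. The same happens to the \<open>d\<close>
      defect for \<open>n \<le> 2\<close>.\<close>
    have c: "smult (c' t (n - 1) - (c t (n - 1) * (b t n - b t (n - 1)) + d t (n - 1) * a t (n + 1)
        - d t (n - 2) * a t (n - 1))) (p t (n - 1)) = 0"
    proof (cases "n = 1")
      case False
      then have "n - 1 \<ge> 1" "n - 1 + 1 = n" "n - 1 + 2 = n + 1" "n - 1 - 1 = n - 2" using n by auto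
      then show ?thesis using assms unfolding toda_iff by auto
    qed simp
    have d: "smult (d' t (n - 2) - d t (n - 2) * (b t n - b t (n - 2))) (p t (n - 2)) = 0"
    proof (cases "n < 3")
      case True
      then have "n = 1 \<or> n = 2" using n by auto
      then show ?thesis by auto
    next
      case False
      then have "n - 2 \<ge> 1" "n - 2 + 2 = n" by auto
      then show ?thesis using assms unfolding toda_iff by auto
    qed
    show ?thesis
      using residual_rec [OF n(2), of t] unfolding IH ab c d n(1) by simp
  qed
qed

lemma coeff_p_lead: "i \<ge> 1 \<Longrightarrow> coeff (p t i) (i - 1) = 1"
  using coeff_opoly_lead [of _ _ _ _ "i - 1"] by (simp add: p_def)

lemma coeff_p_ge: "i \<le> k \<Longrightarrow> coeff (p t i) k = 0"
  by (simp add: p_def coeff_opoly_ge)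

text \<open>The degrees are distinct, so the coefficients at \<open>x^i\<close>,
  \<open>x^(i - 1)\<close>, \<open>x^(i - 2)\<close>, \<open>x^(i - 3)\<close> give the four claims
  in turn. The side conditions keep \<open>p (i - 1)\<close> and \<open>p (i - 2)\<close> away from
  \<open>p 0 = 0\<close>.\<close>

lemma p_independent4:
  assumes "i \<ge> 1"
    and "smult \<alpha> (p t (i + 1)) + smult \<beta> (p t i) + smult \<gamma> (p t (i - 1)) + smult \<delta> (p t (i - 2)) = 0"
  shows "\<alpha> = 0" "\<beta> = 0" "i \<ge> 2 \<Longrightarrow> \<gamma> = 0" "i \<ge> 3 \<Longrightarrow> \<delta> = 0"
proof -
  have co: "\<alpha> * coeff (p t (i + 1)) k + \<beta> * coeff (p t i) k + \<gamma> * coeff (p t (i - 1)) k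
      + \<delta> * coeff (p t (i - 2)) k = 0" for k
    using arg_cong [OF assms(2), of "\<lambda>q. coeff q k"] by simp
  show \<alpha>: "\<alpha> = 0"
    using co [of i] coeff_p_lead [of "i + 1" t] by (simp add: coeff_p_ge)
  show \<beta>: "\<beta> = 0"
    using co [of "i - 1"] coeff_p_lead [of i t] assms(1) by (simp add: coeff_p_ge \<alpha>)
  show \<gamma>: "\<gamma> = 0" if "i \<ge> 2"
  proof -
    have "i - 1 \<ge> 1" "i - 1 - 1 = i - 2" using that by auto
    then show ?thesis
      using co [of "i - 2"] coeff_p_lead [of "i - 1" t] by (simp add: coeff_p_ge \<alpha> \<beta>)
  qed
  show "\<delta> = 0" if "i \<ge> 3"
  proof -
    have "i - 2 \<ge> 1" "i - 2 - 1 = i - 3" "\<gamma> = 0" using that \<gamma> by auto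
    then show ?thesis
      using co [of "i - 3"] coeff_p_lead [of "i - 2" t] by (simp add: \<alpha> \<beta>)
  qed
qed

text \<open>If the residuals vanish, so does the combination of defects in
  \<open>residual_rec\<close>, and linear independence separates them. Row \<open>i\<close> contains
  the equations for \<open>a (i + 1)\<close>, \<open>b i\<close>, \<open>c (i - 1)\<close> and
  \<open>d (i - 2)\<close>; the one for \<open>a 1\<close> occurs in no row and is
  \<open>a1\<close>.\<close>

lemma toda_if_residual_zero:
  assumes "\<And>t i. residual t i = 0"
  shows "toda_system a b c d"
  unfolding toda_iff
proof (intro allI impI)
  fix t and n :: nat
  assume n: "n \<ge> 1"
  have rel: "0 = smult (a' t (i + 1) - (c t (i + 1) - c t (i - 1))) (p t (i + 1))
    + smult (b' t i - (c t i * a t (i + 1) - c t (i - 1) * a t i + d t i - d t (i - 2))) (p t i)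
    + smult (c' t (i - 1) - (c t (i - 1) * (b t i - b t (i - 1)) + d t (i - 1) * a t (i + 1)
        - d t (i - 2) * a t (i - 1))) (p t (i - 1))
    + smult (d' t (i - 2) - d t (i - 2) * (b t i - b t (i - 2))) (p t (i - 2))" if "i \<ge> 1" for i
    using residual_rec [OF that, of t] by (simp only: assms smult_0_right mult_zero_right add_0 diff_self)
  note zero = p_independent4 [OF _ rel [symmetric]]
  have "a' t n = c t n - c t (n - 2)"
  proof (cases "n = 1")
    case True
    then show ?thesis using a1 by simp
  next
    case False
    then have "n - 1 \<ge> 1" "n - 1 + 1 = n" "n - 1 - 1 = n - 2" using n by auto
    then show ?thesis using zero(1) [of "n - 1"] by simp
  qed
  moreover have "b' t n = c t n * a t (n + 1) - c t (n - 1) * a t n + d t n - d t (n - 2)"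
    using zero(2) [of n] n by simp
  moreover have "c' t n = c t n * (b t (n + 1) - b t n) + d t n * a t (n + 2) - d t (n - 1) * a t n"
    using zero(3) [of "n + 1"] n by simp
  moreover have "d' t n = d t n * (b t (n + 2) - b t n)"
    using zero(4) [of "n + 2"] n by simp
  ultimately show "a' t n = c t n - c t (n - 2) \<and>
     b' t n = c t n * a t (n + 1) - c t (n - 1) * a t n + d t n - d t (n - 2) \<and>
     c' t n = c t n * (b t (n + 1) - b t n) + d t n * a t (n + 2) - d t (n - 1) * a t n \<and>
     d' t n = d t n * (b t (n + 2) - b t n)"
    by blast
qed

lemma toda_iff_residual: "toda_system a b c d \<longleftrightarrow> (\<forall>t i. residual t i = 0)"
  using residual_zero_if_toda toda_if_residual_zero by blast

lemma residual_zero_iff: "residual t i = 0 \<longleftrightarrow> pdot t i = - strict_lower (c t) (d t) (p t) i"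
  by (simp add: residual_def eq_neg_iff_add_eq_0)

lemma residual_zero_iff_ge1: "(\<forall>t i. residual t i = 0) \<longleftrightarrow> (\<forall>t. \<forall>i\<ge>1. residual t i = 0)"
  by (metis One_nat_def Suc_leI neq0_conv residual_simps(1))

section \<open>Conditions (f) and (g)\<close>

lemma Bvec_p:
  "Bvec (a t) (b t) (c t) (d t) m $ 1 = p t (2 * m + 1)"
  "Bvec (a t) (b t) (c t) (d t) m $ 2 = p t (2 * m + 2)"
  using Bvec_opoly [of "c t" "d t"] by (simp_all add: p_def)

lemma prev_Bvec_p:
  "prev (Bvec (a t) (b t) (c t) (d t)) m $ 1 = p t (2 * m - 1)"
  "prev (Bvec (a t) (b t) (c t) (d t)) m $ 2 = p t (2 * m)"
  by (auto simp: prev_def Bvec_p split: nat.splits)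

text \<open>The two entries of \<open>C_m B_(m-1) + D_m B_m\<close> are \<open>strict_lower\<close>
  at the indices \<open>2m + 1\<close> and \<open>2m + 2\<close>, so (f) says
  \<open>pdot = - strict_lower\<close> at every positive index.\<close>

lemma Bvec_evolution_iff: "Bvec_evolution a b c d \<longleftrightarrow> (\<forall>t i. residual t i = 0)"
proof -
  have "Bvec_evolution a b c d \<longleftrightarrow> (\<forall>t m x.
      ((\<lambda>s. poly (p s (2 * m + 1)) x) has_vector_derivative
         poly (- strict_lower (c t) (d t) (p t) (2 * m + 1)) x) (at t) \<and>
      ((\<lambda>s. poly (p s (2 * m + 2)) x) has_vector_derivative
         poly (- strict_lower (c t) (d t) (p t) (2 * m + 2)) x) (at t))"
    unfolding Bvec_evolution_def has_vector_derivative_vec_iff forall_2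
    by (simp add: eval_vec_def Bvec_p prev_Bvec_p matrix_vector_mult_def sum_2 Cblk_def Dblk_def
      mat2_def strict_lower_def algebra_simps)
  also have "\<dots> \<longleftrightarrow> (\<forall>t. \<forall>i\<ge>1. \<forall>x. ((\<lambda>s. poly (p s i) x) has_vector_derivative
         poly (- strict_lower (c t) (d t) (p t) i) x) (at t))"
    unfolding all_nat_parity by blast
  also have "\<dots> \<longleftrightarrow> (\<forall>t. \<forall>i\<ge>1. residual t i = 0)"
    unfolding has_poly_derivative_poly_iff [OF pdot] residual_zero_iff ..
  finally show ?thesis
    unfolding residual_zero_iff_ge1 .
qed

lemma prev_Vmat_parts:
  "prev (Vmat (a t) (b t) (c t) (d t)) m $ 1 $ 1 = even_part (p t (2 * m - 1))"
  "prev (Vmat (a t) (b t) (c t) (d t)) m $ 1 $ 2 = odd_part (p t (2 * m - 1))"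
  "prev (Vmat (a t) (b t) (c t) (d t)) m $ 2 $ 1 = even_part (p t (2 * m))"
  "prev (Vmat (a t) (b t) (c t) (d t)) m $ 2 $ 2 = odd_part (p t (2 * m))"
  by (auto simp: prev_def Vmat_parts Bvec_p even_part_linear odd_part_linear split: nat.splits)

lemma Vmat_evolution_iff: "Vmat_evolution a b c d \<longleftrightarrow> (\<forall>t i. residual t i = 0)"
proof -
  have "Vmat_evolution a b c d \<longleftrightarrow> (\<forall>t m x.
      (((\<lambda>s. poly (even_part (p s (2 * m + 1))) x) has_vector_derivative
         poly (even_part (- strict_lower (c t) (d t) (p t) (2 * m + 1))) x) (at t) \<and>
      ((\<lambda>s. poly (odd_part (p s (2 * m + 1))) x) has_vector_derivative
         poly (odd_part (- strict_lower (c t) (d t) (p t) (2 * m + 1))) x) (at t)) \<and>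
      ((\<lambda>s. poly (even_part (p s (2 * m + 2))) x) has_vector_derivative
         poly (even_part (- strict_lower (c t) (d t) (p t) (2 * m + 2))) x) (at t) \<and>
      ((\<lambda>s. poly (odd_part (p s (2 * m + 2))) x) has_vector_derivative
         poly (odd_part (- strict_lower (c t) (d t) (p t) (2 * m + 2))) x) (at t))"
    unfolding Vmat_evolution_def has_vector_derivative_vec_iff forall_2
    by (simp add: eval_mat_def map_matrix_def Vmat_parts Bvec_p prev_Vmat_parts
      matrix_matrix_mult_def sum_2 Cblk_def Dblk_def
      mat2_def strict_lower_def even_part_linear odd_part_linear algebra_simps)
  also have "\<dots> \<longleftrightarrow> (\<forall>t. \<forall>i\<ge>1. (\<forall>x. ((\<lambda>s. poly (even_part (p s i)) x) has_vector_derivative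
         poly (even_part (- strict_lower (c t) (d t) (p t) i)) x) (at t)) \<and>
       (\<forall>x. ((\<lambda>s. poly (odd_part (p s i)) x) has_vector_derivative
         poly (odd_part (- strict_lower (c t) (d t) (p t) i)) x) (at t)))"
    unfolding all_nat_parity by blast
  also have "\<dots> \<longleftrightarrow> (\<forall>t. \<forall>i\<ge>1. residual t i = 0)"
    unfolding has_poly_derivative_poly_iff [OF has_poly_derivative_even_part [OF pdot]]
      has_poly_derivative_poly_iff [OF has_poly_derivative_odd_part [OF pdot]] residual_zero_iff
    using even_odd_part_eqI by metis
  finally show ?thesis
    unfolding residual_zero_iff_ge1 .
qed

end

section \<open>Products with the pentadiagonal matrix\<close>

text \<open>A row meets at most five columns. In rows 1 and 2 truncated subtraction sends the
  missing neighbours on the left to index 0, where \<open>c 0 = d 0 = 0\<close> removes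
  them.\<close>

lemma Jmat_infsum:
  assumes "c 0 = 0" "d 0 = 0" "i \<ge> 1"
  shows "(\<Sum>\<^sub>\<infinity>k\<in>{1..}. Jmat a b c d i k * f k) = f (i + 2) + a (i + 1) * f (i + 1) + b i * f i
    + c (i - 1) * f (i - 1) + d (i - 2) * f (i - 2)"
proof -
  let ?J = "Jmat a b c d i"
  have "(\<Sum>\<^sub>\<infinity>k\<in>{1..}. ?J k * f k) = (\<Sum>\<^sub>\<infinity>k\<in>{1..} \<inter> {i - 2..i + 2}. ?J k * f k)"
    by (rule infsum_cong_neutral) (auto simp: Jmat_def)
  also have "\<dots> = (\<Sum>k\<in>{1..} \<inter> {i - 2..i + 2}. ?J k * f k)"
    by simp
  also have "\<dots> = f (i + 2) + a (i + 1) * f (i + 1) + b i * f i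
    + c (i - 1) * f (i - 1) + d (i - 2) * f (i - 2)"
  proof -
    consider "i = 0" | "i = 1" | "i = 2" | n where "i = Suc (Suc (Suc n))"
      by (rule nat3_cases)
    then show ?thesis
    proof cases
      case 2
      then have "{1..} \<inter> {i - 2..i + 2} = {1, 2, 3}" by auto
      then show ?thesis using 2 assms by (simp add: Jmat_def numeral_2_eq_2 numeral_3_eq_3)
    next
      case 3
      then have "{1..} \<inter> {i - 2..i + 2} = {1, 2, 3, 4}" by auto
      then show ?thesis using 3 assms by (simp add: Jmat_def numeral_eq_Suc)
    next
      case (4 n)
      then have "{1..} \<inter> {i - 2..i + 2} = {n + 1, n + 2, n + 3, n + 4, n + 5}" by auto
      then show ?thesis using 4 by (simp add: Jmat_def numeral_eq_Suc)
    qed (use assms in simp)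
  qed
  finally show ?thesis .
qed

text \<open>In row \<open>i\<close> the strictly lower part acts like the full matrix on the
  sequence cut off at \<open>i\<close>.\<close>

lemma Jmat_lower_infsum:
  assumes "c 0 = 0" "d 0 = 0" "i \<ge> 1"
  shows "(\<Sum>\<^sub>\<infinity>k\<in>{1..}. imat_lower (Jmat a b c d) i k * f k) = c (i - 1) * f (i - 1) + d (i - 2) * f (i - 2)"
proof -
  have "imat_lower (Jmat a b c d) i k * f k = Jmat a b c d i k * (if k < i then f k else 0)" for k
    by (simp add: imat_lower_def)
  then show ?thesis
    using Jmat_infsum [of c d i a b, OF assms, of "\<lambda>k. if k < i then f k else 0"] assms
    by (auto simp: le_Suc_eq)
qed

text \<open>The square of the strictly lower part cancels. What remains is the commutator of the
  upper part, diagonal included, with the lower part; its bands run from the second subdiagonal to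
  the first superdiagonal, hence the four cases.\<close>

lemma Jmat_commutator:
  assumes "c 0 = 0" "d 0 = 0" "i \<ge> 1" "j \<ge> 1"
  shows "imat_mult (Jmat a b c d) (imat_lower (Jmat a b c d)) i j
      - imat_mult (imat_lower (Jmat a b c d)) (Jmat a b c d) i j =
    (if j = i then c i * a (i + 1) - c (i - 1) * a i + d i - d (i - 2)
     else if j = i + 1 then c j - c (j - 2)
     else if i = j + 1 then c j * (b (j + 1) - b j) + d j * a (j + 2) - d (j - 1) * a j
     else if i = j + 2 then d j * (b (j + 2) - b j)
     else 0)"
  unfolding imat_mult_def Jmat_infsum [of c d i a b, OF assms(1-3)]
    Jmat_lower_infsum [of c d i a b, OF assms(1-3)]
proof -
  let ?L = "imat_lower (Jmat a b c d)" and ?J = "Jmat a b c d"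
  consider "i = 0" | "i = 1" | "i = 2" | n where "i = Suc (Suc (Suc n))"
    by (rule nat3_cases)
  then show "?L (i + 2) j + a (i + 1) * ?L (i + 1) j + b i * ?L i j + c (i - 1) * ?L (i - 1) j
      + d (i - 2) * ?L (i - 2) j - (c (i - 1) * ?J (i - 1) j + d (i - 2) * ?J (i - 2) j) =
    (if j = i then c i * a (i + 1) - c (i - 1) * a i + d i - d (i - 2)
     else if j = i + 1 then c j - c (j - 2)
     else if i = j + 1 then c j * (b (j + 1) - b j) + d j * a (j + 2) - d (j - 1) * a j
     else if i = j + 2 then d j * (b (j + 2) - b j)
     else 0)"
  proof cases
    case 2
    then show ?thesis using assms
      by (auto simp: imat_lower_def Jmat_def algebra_simps numeral_2_eq_2 numeral_3_eq_3)
  next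
    case 3
    then show ?thesis using assms
      by (auto simp: imat_lower_def Jmat_def algebra_simps numeral_2_eq_2 numeral_3_eq_3)
  next
    case (4 n)
    then show ?thesis using assms
      by (auto simp: imat_lower_def Jmat_def algebra_simps numeral_2_eq_2 numeral_3_eq_3)
  qed (use assms in simp)
qed

context flow
begin

lemma Jmat_derivative:
  "((\<lambda>s. Jmat (a s) (b s) (c s) (d s) i j) has_vector_derivative
     (if j = i then b' t i else if j = i + 1 then a' t j else if i = j + 1 then c' t j
      else if i = j + 2 then d' t j else 0)) (at t)"
  unfolding Jmat_def using a' b' c' d' by (auto cong: if_cong)

text \<open>The matrices are compared entry by entry. As \<open>a 1\<close> is not an entry of
  \<open>J\<close>, its equation comes from \<open>a1\<close> again.\<close>

lemma lax_iff: "lax_equation (\<lambda>t. Jmat (a t) (b t) (c t) (d t)) \<longleftrightarrow> toda_system a b c d"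
proof -
  have "lax_equation (\<lambda>t. Jmat (a t) (b t) (c t) (d t)) \<longleftrightarrow> (\<forall>t. \<forall>i\<ge>1. \<forall>j\<ge>1.
     (if j = i then b' t i else if j = i + 1 then a' t j else if i = j + 1 then c' t j
      else if i = j + 2 then d' t j else 0) =
     (if j = i then c t i * a t (i + 1) - c t (i - 1) * a t i + d t i - d t (i - 2)
     else if j = i + 1 then c t j - c t (j - 2)
     else if i = j + 1 then c t j * (b t (j + 1) - b t j) + d t j * a t (j + 2) - d t (j - 1) * a t j
     else if i = j + 2 then d t j * (b t (j + 2) - b t j)
     else 0))" (is "_ \<longleftrightarrow> (\<forall>t. \<forall>i\<ge>1. \<forall>j\<ge>1. ?l t i j = ?r t i j)")
  proof -
    have "((\<lambda>s. Jmat (a s) (b s) (c s) (d s) i j) has_vector_derivative D) (at t) \<longleftrightarrow> ?l t i j = D" for t i j D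
      using Jmat_derivative [of i j t] vector_derivative_unique_at by blast
    then show ?thesis
      unfolding lax_equation_def by (simp only: Jmat_commutator c0 d0 cong: imp_cong)
  qed
  also have "\<dots> \<longleftrightarrow> toda_system a b c d"
  proof
    assume *: "\<forall>t. \<forall>i\<ge>1. \<forall>j\<ge>1. ?l t i j = ?r t i j"
    show "toda_system a b c d"
      unfolding toda_iff
    proof (intro allI impI conjI)
      fix t and n :: nat
      assume n: "n \<ge> 1"
      show "a' t n = c t n - c t (n - 2)"
      proof (cases "n = 1")
        case False
        then obtain m where "n = Suc m" "m \<ge> 1" using n by (cases n) auto
        then show ?thesis using *[rule_format, of m n t] by (simp add: numeral_2_eq_2)
      qed (use a1 in simp)
    qed (use *[rule_format, of n n for n] *[rule_format, of "n + 1" n for n]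
        *[rule_format, of "n + 2" n for n] in auto)
  next
    assume "toda_system a b c d"
    then show "\<forall>t. \<forall>i\<ge>1. \<forall>j\<ge>1. ?l t i j = ?r t i j"
      unfolding toda_iff by auto
  qed
  finally show ?thesis .
qed

end

section \<open>The functionals\<close>

locale flow_functional = flow +
  fixes U :: "real \<Rightarrow> fvec"
  assumes U_linear: "linear_functionals (U t)"
    and U_normalized: "normalized (U t)"
    and U_orthogonal: "left_orthogonal (a t) (b t) (c t) (d t) (U t)"
    and d_nonzero: "n \<ge> 1 \<Longrightarrow> d t n \<noteq> 0"
begin

lemma u_linear: "plinear (U t $ j)"
  using U_linear by (rule linear_functionals_plinear)

lemma monom_0_1: "monom 1 0 = (1 :: complex poly)" "monom 1 (Suc 0) = ([:0, 1:] :: complex poly)"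
  by (simp_all add: monom_altdef)

lemma u_normalized:
  "(U t $ 1) (monom 1 0) = 1" "(U t $ 2) (monom 1 0) = 0"
  "(U t $ 1) (monom 1 1) = 0" "(U t $ 2) (monom 1 1) = 1"
  using U_normalized [of t]
  by (simp_all add: normalized_def fapply_def Pvec0_def mat_def vec_eq_iff forall_2 monom_0_1)

text \<open>The polynomials of index at least 3 are the entries of \<open>Bvec\<close> with
  \<open>m \<ge> 1\<close>; orthogonality with \<open>k = 0\<close> makes both functionals vanish
  there.\<close>

lemma u_p:
  assumes "i \<ge> 3"
  shows "(U t $ j) (p t i) = 0"
proof -
  obtain m where m: "m \<ge> 1" "i = 2 * m + 1 \<or> i = 2 * m + 2"
  proof
    show "(i - 1) div 2 \<ge> 1" "i = 2 * ((i - 1) div 2) + 1 \<or> i = 2 * ((i - 1) div 2) + 2"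
      using assms by presburger+
  qed
  have "fapply (fshift (2 * 0) (U t)) (Bvec (a t) (b t) (c t) (d t) m) = 0"
  proof -
    obtain \<Delta> :: "nat \<Rightarrow> complex^2^2" where "\<forall>m. \<forall>k\<le>m. fapply (fshift (2 * k) (U t))
        (Bvec (a t) (b t) (c t) (d t) m) = (if k = m then \<Delta> m else 0)"
      using U_orthogonal [of t] unfolding left_orthogonal_def by blast
    from this [rule_format, of 0 m] show ?thesis using m(1) by simp
  qed
  then have "(U t $ j) (Bvec (a t) (b t) (c t) (d t) m $ 1) = 0" "(U t $ j) (Bvec (a t) (b t) (c t) (d t) m $ 2) = 0"
    using exhaust_2 [of j] by (auto simp: fapply_def fshift_def vec_eq_iff forall_2)
  then show ?thesis
    using m(2) by (auto simp: Bvec_p)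
qed

text \<open>Together with \<open>w\<close>, the functional \<open>v\<close> is dual to the basis \<open>p\<close>: \<open>v\<close> is 1 at \<open>p 1\<close>, \<open>w\<close> is 1
  at \<open>p 2\<close>, and both vanish at the other members.\<close>

definition v :: "real \<Rightarrow> complex poly \<Rightarrow> complex" where
  "v t P = (U t $ 1) P + a t 1 * (U t $ 2) P"

definition w :: "real \<Rightarrow> complex poly \<Rightarrow> complex" where
  "w t P = (U t $ 2) P"

lemma v_linear: "plinear (v t)" and w_linear: "plinear (w t)"
  using u_linear [of t] unfolding plinear_def v_def w_def by (simp_all add: algebra_simps)

lemma p2: "p t 2 = monom 1 1 - smult (a t 1) (monom 1 0)"
  by (simp add: monom_altdef)

lemma v_p: "v t (p t 1) = 1" "i \<ge> 2 \<Longrightarrow> v t (p t i) = 0"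
proof -
  show "v t (p t 1) = 1"
    using u_normalized [of t] by (simp add: v_def monom_0_1)
  have "v t (p t 2) = 0"
    unfolding p2 v_def by (simp only: plinear_simps [OF u_linear] u_normalized) simp
  moreover have "i \<ge> 3 \<Longrightarrow> v t (p t i) = 0"
    by (simp add: v_def u_p)
  ultimately show "i \<ge> 2 \<Longrightarrow> v t (p t i) = 0"
    by (cases "i = 2") auto
qed

lemma w_p: "w t (p t 1) = 0" "w t (p t 2) = 1" "i \<ge> 3 \<Longrightarrow> w t (p t i) = 0"
proof -
  show "w t (p t 1) = 0"
    using u_normalized [of t] by (simp add: w_def monom_0_1)
  show "w t (p t 2) = 1"
    unfolding p2 w_def by (simp only: plinear_simps [OF u_linear] u_normalized) simp
  show "i \<ge> 3 \<Longrightarrow> w t (p t i) = 0"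
    by (simp add: w_def u_p)
qed

text \<open>These are the entries of \<open>J_11\<close>, read off from the first two rows of the
  recurrence by duality.\<close>

lemma vw_square_p:
  "v t (monom 1 2 * p t 1) = b t 1" "w t (monom 1 2 * p t 1) = a t 2"
  "v t (monom 1 2 * p t 2) = c t 1" "w t (monom 1 2 * p t 2) = b t 2"
proof -
  have e: "monom 1 2 * p t 1 = p t 3 + smult (a t 2) (p t 2) + smult (b t 1) (p t 1)"
    "monom 1 2 * p t 2 = p t 4 + smult (a t 3) (p t 3) + smult (b t 2) (p t 2) + smult (c t 1) (p t 1)"
    using p_rec [of 1 t] p_rec [of 2 t] by (simp_all add: strict_lower_def numeral_eq_Suc)
  show "v t (monom 1 2 * p t 1) = b t 1" "w t (monom 1 2 * p t 1) = a t 2"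
    "v t (monom 1 2 * p t 2) = c t 1" "w t (monom 1 2 * p t 2) = b t 2"
    unfolding e by (simp_all add: plinear_simps [OF v_linear] plinear_simps [OF w_linear]
      v_p w_p del: p_simps One_nat_def)
qed

text \<open>The evolution law of (b), (c) and (e) at \<open>P\<close>, in terms of \<open>v\<close> and \<open>w\<close>.\<close>

definition evolves :: "real \<Rightarrow> complex poly \<Rightarrow> bool" where
  "evolves t P \<longleftrightarrow>
     ((\<lambda>s. v s P) has_vector_derivative v t (monom 1 2 * P) - b t 1 * v t P) (at t) \<and>
     ((\<lambda>s. w s P) has_vector_derivative w t (monom 1 2 * P) - a t 2 * v t P - b t 2 * w t P) (at t)"

section \<open>Conditions (c) and (e) as the evolution law\<close>

lemma moment_1:
  "(U t $ 2) (monom 1 2) = a t 2" "(U t $ 1) (monom 1 2) = b t 1 - a t 1 * a t 2"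
  "(U t $ 2) (monom 1 3) = b t 2 + a t 1 * a t 2"
  "(U t $ 1) (monom 1 3) = c t 1 + a t 1 * b t 1 - a t 1 * (b t 2 + a t 1 * a t 2)"
proof -
  have e: "monom 1 2 * p t 1 = monom 1 2" "monom 1 2 * p t 2 = monom 1 3 - smult (a t 1) (monom 1 2)"
    unfolding p2 by (simp_all add: right_diff_distrib mult_monom numeral_3_eq_3)
  note vw = vw_square_p [of t, unfolded e]
  show u2: "(U t $ 2) (monom 1 2) = a t 2" using vw(2) by (simp add: w_def)
  show u1: "(U t $ 1) (monom 1 2) = b t 1 - a t 1 * a t 2" using vw(1) by (simp add: v_def u2 eq_diff_eq)
  show u2': "(U t $ 2) (monom 1 3) = b t 2 + a t 1 * a t 2"
    using vw(4) by (simp add: w_def plinear_simps [OF u_linear] u2 diff_eq_eq)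
  show "(U t $ 1) (monom 1 3) = c t 1 + a t 1 * b t 1 - a t 1 * (b t 2 + a t 1 * a t 2)"
    using vw(3) by (simp add: v_def plinear_simps [OF u_linear] u2 u1 u2' algebra_simps)
qed

text \<open>The right-hand side is a row of \<open>U(x^2 P) - U(P) U_1\<close>. The passage between
  \<open>v\<close>, \<open>w\<close> and the two functionals uses the product rule for
  \<open>a_1 u^2\<close>; the derivative \<open>c_1\<close> of \<open>a_1\<close> accounts for the
  entry \<open>c_1\<close> contained in \<open>U_1\<close>.\<close>

lemma evolves_iff:
  "evolves t P \<longleftrightarrow> (\<forall>j. ((\<lambda>s. (U s $ j) P) has_vector_derivative
     (U t $ j) (monom 1 2 * P) - ((U t $ 1) P * (U t $ j) (monom 1 2)
       + (U t $ 2) P * (U t $ j) (monom 1 3))) (at t))" (is "_ \<longleftrightarrow> ?R")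
proof -
  let ?u1 = "(U t $ 1) P" and ?u2 = "(U t $ 2) P"
  define D1 where "D1 = (U t $ 1) (monom 1 2 * P) - (?u1 * (U t $ 1) (monom 1 2) + ?u2 * (U t $ 1) (monom 1 3))"
  define D2 where "D2 = (U t $ 2) (monom 1 2 * P) - (?u1 * (U t $ 2) (monom 1 2) + ?u2 * (U t $ 2) (monom 1 3))"
  define Dv where "Dv = v t (monom 1 2 * P) - b t 1 * v t P"
  have Dw: "w t (monom 1 2 * P) - a t 2 * v t P - b t 2 * w t P = D2"
    unfolding D2_def moment_1 v_def w_def by algebra
  have Dv_eq: "Dv = D1 + (a t 1 * D2 + c t 1 * ?u2)"
    unfolding Dv_def D1_def D2_def moment_1 v_def by algebra
  have a1': "((\<lambda>s. a s 1) has_vector_derivative c t 1) (at t)"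
    using a' [of 1 t] unfolding a1 .
  have "((\<lambda>s. v s P) has_vector_derivative Dv) (at t) \<longleftrightarrow> ((\<lambda>s. (U s $ 1) P) has_vector_derivative D1) (at t)"
    if u2: "((\<lambda>s. (U s $ 2) P) has_vector_derivative D2) (at t)"
  proof -
    note m = has_vector_derivative_mult [OF a1' u2]
    show ?thesis
      unfolding v_def Dv_eq
      \<comment> \<open>One direction adds the path \<open>a s 1 * (U s $ 2) P\<close>, the other
        subtracts it.\<close>
      using has_vector_derivative_add [OF _ m, of "\<lambda>s. (U s $ 1) P" D1]
        has_vector_derivative_diff [OF _ m, of "\<lambda>s. (U s $ 1) P + a s 1 * (U s $ 2) P" "D1 + (a t 1 * D2 + c t 1 * ?u2)"]
      by auto
  qed
  then show ?thesis
    unfolding evolves_def Dw Dv_def [symmetric] forall_2 D1_def [symmetric] D2_def [symmetric]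
    unfolding w_def by blast
qed

lemma square_Pvec0: "monom 1 n * Pvec0 $ 1 = monom 1 n" "monom 1 n * Pvec0 $ 2 = monom 1 (Suc n)"
  by (simp_all add: Pvec0_def monom_altdef)

lemma fapply_nth: "fapply W P $ i $ j = (W $ j) (P $ i)"
  by (simp add: fapply_def)

lemma evolution_component:
  "((fapply (U t) (monom 1 2 *s P) - fapply (U t) P ** moment (U t) 1) $ i $ j) =
   (U t $ j) (monom 1 2 * P $ i) - ((U t $ 1) (P $ i) * (U t $ j) (monom 1 2)
       + (U t $ 2) (P $ i) * (U t $ j) (monom 1 3))"
  by (simp add: fapply_def moment_def matrix_matrix_mult_def sum_2 square_Pvec0 numeral_3_eq_3)

lemma functional_evolution_iff: "functional_evolution U \<longleftrightarrow> (\<forall>t P. evolves t P)"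
proof -
  have "functional_evolution U \<longleftrightarrow> (\<forall>t P. ((\<lambda>s. fapply (U s) P) has_vector_derivative
       fapply (U t) (monom 1 2 *s P) - fapply (U t) P ** moment (U t) 1) (at t))"
    unfolding functional_evolution_def has_vector_derivative_iff_quotient ..
  also have "\<dots> \<longleftrightarrow> (\<forall>t P. \<forall>i::2. evolves t (P $ i))"
    unfolding has_vector_derivative_vec_iff evolution_component evolves_iff fapply_nth ..
  also have "\<dots> \<longleftrightarrow> (\<forall>t P. evolves t P)"
  proof
    assume *: "\<forall>t P. \<forall>i::2. evolves t (P $ i)"
    show "\<forall>t P. evolves t P"
    proof (intro allI)
      fix t P
      show "evolves t P" using *[rule_format, of t "\<chi> i. P" 1] by simp
    qed
  qed simp
  finally show ?thesis .
qed

text \<open>By normalization \<open>U_0 = I\<close> is constant in time, and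
  \<open>U_1 - U_0 U_1 = 0\<close>. This supplies the case \<open>n = 0\<close>, which (c) leaves
  out.\<close>

lemma evolves_low: "evolves t (monom 1 0)" "evolves t (monom 1 1)"
  unfolding evolves_iff forall_2
  by (simp_all only: u_normalized, simp_all add: mult_monom numeral_3_eq_3 numeral_2_eq_2 has_vector_derivative_const)

lemma moment_evolution_iff: "moment_evolution U \<longleftrightarrow> (\<forall>t k. evolves t (monom 1 k))"
proof -
  have "moment_evolution U \<longleftrightarrow> (\<forall>t. \<forall>n\<ge>1. evolves t (monom 1 (2 * n)) \<and> evolves t (monom 1 (2 * n + 1)))"
  proof -
    have m: "moment (U t) n = fapply (U t) (monom 1 (2 * n) *s Pvec0)" for t n
      by (simp add: moment_def)
    have m1: "moment (U t) (n + 1) = fapply (U t) (monom 1 2 *s (monom 1 (2 * n) *s Pvec0))" for t n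
      by (simp add: moment_def vector_scalar_mult_def mult.assoc [symmetric] mult_monom)
    have nth: "(monom 1 (2 * n) *s Pvec0) $ 1 = monom 1 (2 * n)"
      "(monom 1 (2 * n) *s Pvec0) $ 2 = monom 1 (2 * n + 1)" for n
      by (simp_all add: square_Pvec0)
    have "((\<lambda>s. moment (U s) n) has_vector_derivative
        moment (U t) (n + 1) - moment (U t) n ** moment (U t) 1) (at t)
      \<longleftrightarrow> (\<forall>i. evolves t ((monom 1 (2 * n) *s Pvec0) $ i))" for t n
      unfolding m1 m [of _ n] has_vector_derivative_vec_iff evolution_component evolves_iff fapply_nth ..
    then show ?thesis
      unfolding moment_evolution_def forall_2 nth by blast
  qed
  also have "\<dots> \<longleftrightarrow> (\<forall>t. \<forall>k. evolves t (monom 1 k))"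
  proof
    assume *: "\<forall>t. \<forall>n\<ge>1. evolves t (monom 1 (2 * n)) \<and> evolves t (monom 1 (2 * n + 1))"
    show "\<forall>t. \<forall>k. evolves t (monom 1 k)"
    proof (intro allI)
      fix t and k :: nat
      consider "k = 0" | "k = 1" | "k div 2 \<ge> 1" by linarith
      then show "evolves t (monom 1 k)"
      proof cases
        case 3
        moreover have "k = 2 * (k div 2) \<or> k = 2 * (k div 2) + 1" by presburger
        ultimately show ?thesis using * by metis
      qed (use evolves_low in auto)
    qed
  qed auto
  finally show ?thesis .
qed

section \<open>The evolution law and the vanishing of the residual\<close>

lemma evolves_monom_imp:
  assumes mono: "\<And>k. evolves t (monom 1 k)"
  shows "evolves t P"
proof -
  have lin: "plinear (\<lambda>P. v t (monom 1 2 * P) - b t 1 * v t P)"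
    "plinear (\<lambda>P. w t (monom 1 2 * P) - a t 2 * v t P - b t 2 * w t P)"
    unfolding plinear_def
    by (simp_all add: plinear_simps [OF v_linear] plinear_simps [OF w_linear] distrib_left algebra_simps)
  have deg: "\<And>k. Suc (degree P) \<le> k \<Longrightarrow> coeff P k = 0"
    by (simp add: coeff_eq_0)
  show ?thesis
    using plinear_path_derivative [OF v_linear lin(1) _ has_poly_derivative_const deg]
      plinear_path_derivative [OF w_linear lin(2) _ has_poly_derivative_const deg] mono
    unfolding evolves_def by (simp add: plinear_0 [OF v_linear] plinear_0 [OF w_linear])
qed

text \<open>\<open>p (k + 1)\<close> is \<open>x^k\<close> plus terms of lower degree, and for
  \<open>k \<ge> 2\<close> both \<open>v\<close> and \<open>w\<close> vanish on it at all times. So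
  their values at \<open>x^k\<close> are minus those at the lower terms, where the induction
  hypothesis gives the derivative.\<close>

lemma evolves_if_residual_zero:
  assumes res: "\<And>i. residual t i = 0"
  shows "evolves t (monom 1 k)"
proof (induction k rule: less_induct)
  case (less k)
  show ?case
  proof (cases "k < 2")
    case True
    then show ?thesis using evolves_low by (auto simp: less_2_cases_iff)
  next
    case False
    define i where "i = k + 1"
    have i: "i \<ge> 3" using False by (simp add: i_def)
    define \<delta> where "\<delta> P = v t (monom 1 2 * P) - b t 1 * v t P" for P
    define \<epsilon> where "\<epsilon> P = w t (monom 1 2 * P) - a t 2 * v t P - b t 2 * w t P" for P
    have lin: "plinear \<delta>" "plinear \<epsilon>"
      unfolding plinear_def \<delta>_def \<epsilon>_def
      by (simp_all add: plinear_simps [OF v_linear] plinear_simps [OF w_linear] distrib_left algebra_simps)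
    have P: "has_poly_derivative (\<lambda>s. p s i - monom 1 k) (pdot t i) t"
      using has_poly_derivative_diff [OF pdot has_poly_derivative_const] by simp
    have deg: "coeff (p s i - monom 1 k) l = 0" if "k \<le> l" for s l
      using that coeff_p_ge [of i l s] coeff_p_lead [of i s] by (cases "l = k") (auto simp: i_def coeff_monom)
    have mono: "((\<lambda>s. v s (monom 1 l)) has_vector_derivative \<delta> (monom 1 l)) (at t)"
      "((\<lambda>s. w s (monom 1 l)) has_vector_derivative \<epsilon> (monom 1 l)) (at t)" if "l < k" for l
      using less.IH [OF that] by (simp_all add: evolves_def \<delta>_def \<epsilon>_def)
    have pd: "pdot t i = - strict_lower (c t) (d t) (p t) i"
      using res [of i] by (simp add: residual_zero_iff)
    have vi: "v s (p s i) = 0" "w s (p s i) = 0" for s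
      using i by (simp_all add: v_p w_p)
    \<comment> \<open>Of \<open>x^2 p i\<close> only the strictly lower terms are seen by
      \<open>v\<close> and \<open>w\<close>, as all other indices are at least 3; these terms cancel
      against \<open>pdot\<close>.\<close>
    have "\<delta> (p t i) + v t (pdot t i) = 0" "\<epsilon> (p t i) + w t (pdot t i) = 0"
      unfolding \<delta>_def \<epsilon>_def pd using i
      by (simp_all add: p_rec plinear_simps [OF v_linear] plinear_simps [OF w_linear] v_p w_p)
    then have 1: "\<delta> (p t i - monom 1 k) + v t (pdot t i) = - \<delta> (monom 1 k)"
      "\<epsilon> (p t i - monom 1 k) + w t (pdot t i) = - \<epsilon> (monom 1 k)"
      by (simp_all add: plinear_simps [OF lin(1)] plinear_simps [OF lin(2)])
    have 2: "v s (p s i - monom 1 k) = - v s (monom 1 k)" "w s (p s i - monom 1 k) = - w s (monom 1 k)" for s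
      by (simp_all add: plinear_simps [OF v_linear] plinear_simps [OF w_linear] vi)
    have "((\<lambda>s. - v s (monom 1 k)) has_vector_derivative - \<delta> (monom 1 k)) (at t)"
      "((\<lambda>s. - w s (monom 1 k)) has_vector_derivative - \<epsilon> (monom 1 k)) (at t)"
      using plinear_path_derivative [OF v_linear lin(1) mono(1) P deg]
        plinear_path_derivative [OF w_linear lin(2) mono(2) P deg]
      unfolding 1 2 by blast+
    then have "((\<lambda>s. v s (monom 1 k)) has_vector_derivative \<delta> (monom 1 k)) (at t)"
      "((\<lambda>s. w s (monom 1 k)) has_vector_derivative \<epsilon> (monom 1 k)) (at t)"
      using has_vector_derivative_minus by fastforce+
    then show ?thesis
      by (simp add: evolves_def \<delta>_def \<epsilon>_def)
  qed
qed

text \<open>For \<open>l = 1, 2, 3, \<dots>\<close> these are \<open>v, w, v (x\<^sup>2 _), w (x\<^sup>2 _), v (x\<^sup>4 _), \<dots>\<close>; truncated subtraction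
  makes the value at \<open>l = 0\<close> meaningless.\<close>

definition dual :: "real \<Rightarrow> nat \<Rightarrow> complex poly \<Rightarrow> complex" where
  "dual t l P = (if odd l then v t (monom 1 (l - 1) * P) else w t (monom 1 (l - 2) * P))"

lemma dual_linear: "plinear (dual t l)"
  unfolding plinear_def dual_def
  by (simp add: plinear_simps [OF v_linear] plinear_simps [OF w_linear] distrib_left)

lemma dual_step:
  assumes "l \<ge> 1"
  shows "dual t (l + 2) P = dual t l (monom 1 2 * P)"
proof (cases "odd l")
  case True
  then have "l + 2 - 1 = (l - 1) + 2" using assms by simp
  then show ?thesis
    using True by (simp add: dual_def mult.assoc [symmetric] mult_monom)
next
  case False
  then have "l + 2 - 2 = (l - 2) + 2" using assms by (auto elim!: evenE)
  then show ?thesis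
    using False by (simp add: dual_def mult.assoc [symmetric] mult_monom)
qed

lemma dual_low: "dual t 1 P = v t P" "dual t 2 P = w t P"
  by (simp_all add: dual_def monom_0_1(1))

text \<open>Multiplication by \<open>x^2\<close> turns \<open>p i\<close> into a combination whose
  lowest index is \<open>i - 2\<close>, with coefficient \<open>d (i - 2)\<close>. Starting from the
  duality of \<open>v\<close> and \<open>w\<close>, the diagonal values become products of nonzero
  members of \<open>d\<close>.\<close>

lemma dual_triangular:
  assumes "l \<ge> 1"
  shows "(\<forall>i>l. dual t l (p t i) = 0) \<and> dual t l (p t l) \<noteq> 0"
  using assms
proof (induction l rule: less_induct)
  case (less l)
  consider "l = 0" | "l = 1" | "l = 2" | n where "l = Suc (Suc (Suc n))"
    by (rule nat3_cases)
  then show ?case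
  proof cases
    case 2
    then show ?thesis by (auto simp: dual_low v_p simp del: p_simps One_nat_def)
  next
    case 3
    then show ?thesis by (auto simp: dual_low w_p simp del: p_simps)
  next
    case (4 n)
    define m where "m = Suc n"
    have m: "m \<ge> 1" "l = m + 2" using 4 by (auto simp: m_def)
    then have IH: "\<And>i. i > m \<Longrightarrow> dual t m (p t i) = 0" "dual t m (p t m) \<noteq> 0"
      using less.IH [of m] by auto
    have "dual t l (p t i) = 0" if "i > l" for i
      using that unfolding m(2) dual_step [OF m(1)]
      by (simp add: p_rec strict_lower_def plinear_simps [OF dual_linear] IH)
    moreover have "dual t l (p t l) = d t m * dual t m (p t m)"
      unfolding m(2) dual_step [OF m(1)]
      by (simp add: p_rec strict_lower_def plinear_simps [OF dual_linear] IH)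
    ultimately show ?thesis
      using IH(2) d_nonzero [OF m(1)] by simp
  qed (use less in simp)
qed

text \<open>Forward substitution: after expansion in the basis \<open>p\<close>,
  \<open>dual t l\<close> annihilates the terms of index above \<open>l\<close>, those below
  \<open>l\<close> are already zero, and the diagonal value is nonzero.\<close>

lemma eq_0_if_dual_0:
  assumes deg: "\<And>k. n \<le> k \<Longrightarrow> coeff P k = 0"
    and dual: "\<And>l. 1 \<le> l \<Longrightarrow> l \<le> n \<Longrightarrow> dual t l P = 0"
  shows "P = 0"
proof -
  obtain e where e: "P = (\<Sum>l=1..n. smult (e l) (p t l))"
    using opoly_span [OF deg] unfolding p_def by blast
  have "e l = 0" if "1 \<le> l" "l \<le> n" for l
    using that
  proof (induction l rule: less_induct)
    case (less l)
    have "0 = (\<Sum>m=1..n. e m * dual t l (p t m))"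
      using dual [OF less.prems] unfolding e by (simp add: plinear_simps [OF dual_linear])
    also have "\<dots> = (\<Sum>m\<in>{l}. e m * dual t l (p t m))"
    proof (rule sum.mono_neutral_right)
      show "\<forall>m\<in>{1..n} - {l}. e m * dual t l (p t m) = 0"
      proof
        fix m assume "m \<in> {1..n} - {l}"
        then have "m < l \<and> 1 \<le> m \<and> m \<le> n \<or> l < m" by auto
        then show "e m * dual t l (p t m) = 0"
          using less.IH [of m] dual_triangular [OF less.prems(1), of t] by auto
      qed
    qed (use less.prems in auto)
    finally show "e l = 0"
      using dual_triangular [OF less.prems(1), of t] by auto
  qed
  then show ?thesis
    unfolding e by (intro sum.neutral) auto
qed

text \<open>The evolution law is applied to \<open>P\<close> times the power of \<open>x\<close>
  inside \<open>dual\<close>. An even member is coupled to the odd one before it; for odd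
  \<open>l\<close> the coupling \<open>y\<close> is 0, so \<open>dual t 0\<close> never
  contributes.\<close>

lemma dual_derivative:
  assumes "\<And>P. evolves t P" "l \<ge> 1"
  obtains x y where "odd l \<Longrightarrow> y = 0" "\<And>P. ((\<lambda>s. dual s l P) has_vector_derivative
    dual t l (monom 1 2 * P) - x * dual t l P - y * dual t (l - 1) P) (at t)"
proof (cases "odd l")
  case True
  show ?thesis
  proof (rule that [of 0 "b t 1"])
    fix P
    show "((\<lambda>s. dual s l P) has_vector_derivative
      dual t l (monom 1 2 * P) - b t 1 * dual t l P - 0 * dual t (l - 1) P) (at t)"
      using assms(1) [of "monom 1 (l - 1) * P"] True
      by (simp add: dual_def evolves_def mult.left_commute [of "monom 1 2"])
  qed simp
next
  case False
  show ?thesis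
  proof (rule that [of "a t 2" "b t 2"])
    fix P
    have "dual t (l - 1) P = v t (monom 1 (l - 2) * P)"
    proof -
      have "odd (l - 1)" "l - 1 - 1 = l - 2" using False assms(2) by auto
      then show ?thesis by (simp only: dual_def if_True not_False_eq_True)
    qed
    then show "((\<lambda>s. dual s l P) has_vector_derivative
      dual t l (monom 1 2 * P) - b t 2 * dual t l P - a t 2 * dual t (l - 1) P) (at t)"
      using assms(1) [of "monom 1 (l - 2) * P"] False
      by (simp add: dual_def evolves_def mult.left_commute [of "monom 1 2"] algebra_simps)
  qed (use False in simp)
qed

text \<open>Since the residual has degree below \<open>i - 1\<close>, it suffices to test it against
  \<open>dual t l\<close> for \<open>l \<le> i - 1\<close>. For these \<open>l\<close> the pairing
  of \<open>dual s l\<close> with \<open>p s i\<close> is zero at all times, and its derivative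
  gives the claim.\<close>

lemma residual_zero_if_evolves:
  assumes ev: "\<And>P. evolves t P"
  shows "residual t i = 0"
proof (rule eq_0_if_dual_0 [where n = "i - 1" and t = t])
  fix k
  assume "i - 1 \<le> k"
  then show "coeff (residual t i) k = 0"
    by (simp add: residual_def strict_lower_def coeff_pdot coeff_p_ge)
next
  fix l
  assume l: "1 \<le> l" "l \<le> i - 1"
  then have i: "i \<ge> 1" "l < i" by auto
  obtain x y where xy: "odd l \<Longrightarrow> y = 0" "\<And>P. ((\<lambda>s. dual s l P) has_vector_derivative
    dual t l (monom 1 2 * P) - x * dual t l P - y * dual t (l - 1) P) (at t)"
    using dual_derivative [OF ev l(1)] by metis
  define \<delta> where "\<delta> P = dual t l (monom 1 2 * P) - x * dual t l P - y * dual t (l - 1) P" for P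
  have lin: "plinear \<delta>"
    unfolding plinear_def \<delta>_def by (simp add: plinear_simps [OF dual_linear] distrib_left algebra_simps)
  have tri: "dual s l (p s m) = 0" if "m > l" for s m
    using dual_triangular [OF l(1)] that by blast
  have "((\<lambda>s. dual s l (p s i)) has_vector_derivative \<delta> (p t i) + dual t l (pdot t i)) (at t)"
    by (rule plinear_path_derivative [OF dual_linear lin xy(2) [folded \<delta>_def] pdot, where n = i])
      (rule coeff_p_ge)
  then have 0: "\<delta> (p t i) + dual t l (pdot t i) = 0"
    unfolding tri [OF i(2)] using has_vector_derivative_const vector_derivative_unique_at by blast
  have "y * dual t (l - 1) (p t i) = 0"
  proof (cases "odd l")
    case False
    then have "l - 1 \<ge> 1" "i > l - 1" using l by (auto elim!: evenE)
    then show ?thesis using dual_triangular by auto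
  qed (use xy(1) in simp)
  \<comment> \<open>The remaining terms of the recurrence have indices at least \<open>i\<close>,
    hence above \<open>l\<close>.\<close>
  then have "\<delta> (p t i) = dual t l (strict_lower (c t) (d t) (p t) i)"
    using i by (simp add: \<delta>_def p_rec plinear_simps [OF dual_linear] tri)
  with 0 show "dual t l (residual t i) = 0"
    by (simp add: residual_def plinear_simps [OF dual_linear] add.commute)
qed

lemma residual_iff_evolves: "(\<forall>t i. residual t i = 0) \<longleftrightarrow> (\<forall>t k. evolves t (monom 1 k))"
  using evolves_if_residual_zero residual_zero_if_evolves evolves_monom_imp by metis

section \<open>Powers of \<open>J\<close> and condition (b)\<close>

abbreviation (input) Jm :: "real \<Rightarrow> imat" where
  "Jm t \<equiv> Jmat (a t) (b t) (c t) (d t)"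

text \<open>Row \<open>i\<close> of \<open>J\<close> reproduces multiplication of \<open>p i\<close>
  by \<open>x^2\<close>, so applying \<open>J\<close> to the values of a functional raises the power
  of \<open>x\<close> by two.\<close>

lemma J_power_step:
  assumes \<phi>: "plinear \<phi>" and i: "i \<ge> 1"
    and f: "\<And>k. k \<ge> 1 \<Longrightarrow> f k = \<phi> (monom 1 n * p t k)"
  shows "(\<Sum>\<^sub>\<infinity>k\<in>{1..}. Jm t i k * f k) = \<phi> (monom 1 (n + 2) * p t i)"
proof -
  \<comment> \<open>\<open>f\<close> is prescribed from index 1 on; at index 0 the factor
    \<open>c t 0\<close> vanishes, and below it \<open>d t 0\<close>.\<close>
  have c: "c t (i - 1) * f (i - 1) = c t (i - 1) * \<phi> (monom 1 n * p t (i - 1))"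
  proof (cases "i = 1")
    case False
    then show ?thesis using f [of "i - 1"] i by simp
  qed simp
  have d: "d t (i - 2) * f (i - 2) = d t (i - 2) * \<phi> (monom 1 n * p t (i - 2))"
  proof (cases "i \<le> 2")
    case False
    then show ?thesis using f [of "i - 2"] by simp
  qed simp
  have mul: "monom 1 (n + 2) * p t i = monom 1 n * (monom 1 2 * p t i)"
    by (simp add: mult.assoc [symmetric] mult_monom)
  have "\<phi> (monom 1 (n + 2) * p t i) = \<phi> (monom 1 n * p t (i + 2)) + a t (i + 1) * \<phi> (monom 1 n * p t (i + 1))
      + b t i * \<phi> (monom 1 n * p t i) + c t (i - 1) * \<phi> (monom 1 n * p t (i - 1))
      + d t (i - 2) * \<phi> (monom 1 n * p t (i - 2))"
    unfolding mul p_rec [OF i] strict_lower_def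
    by (simp only: distrib_left mult_smult_right plinear_simps [OF \<phi>] add.assoc)
  then show ?thesis
    unfolding Jmat_infsum [of "c t" "d t" i "a t" "b t", OF c0 d0 i] c d
    using i by (simp only: f le_add2 trans_le_add1)
qed

text \<open>For \<open>n = 0\<close>, duality gives the first two columns of the identity matrix;
  each further factor \<open>J\<close> is a \<open>J_power_step\<close>.\<close>

lemma J_power:
  assumes "i \<ge> 1"
  shows "imat_power (Jm t) n i 1 = v t (monom 1 (2 * n) * p t i)"
    and "imat_power (Jm t) n i 2 = w t (monom 1 (2 * n) * p t i)"
proof -
  show "imat_power (Jm t) n i 1 = v t (monom 1 (2 * n) * p t i)"
    using assms
  proof (induction n arbitrary: i)
    case 0
    then show ?case
      using v_p(1) [of t] v_p(2) [of i t] by (cases "i = 1") (auto simp: monom_0_1(1))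
  next
    case (Suc n)
    have "2 * Suc n = 2 * n + 2" by simp
    then show ?case
      unfolding imat_power.simps imat_mult_def using J_power_step [OF v_linear Suc(2,1)] by metis
  qed
  show "imat_power (Jm t) n i 2 = w t (monom 1 (2 * n) * p t i)"
    using assms
  proof (induction n arbitrary: i)
    case 0
    then consider "i = 1" | "i = 2" | "i \<ge> 3" by linarith
    then show ?case
      using w_p(1,2) [of t] w_p(3) [of i t] by cases (auto simp: monom_0_1(1) simp del: p_simps(4))
  next
    case (Suc n)
    have "2 * Suc n = 2 * n + 2" by simp
    then show ?case
      unfolding imat_power.simps imat_mult_def using J_power_step [OF w_linear Suc(2,1)] by metis
  qed
qed

lemma J_power_block:
  "imat_block (imat_power (Jm t) n) 1 1 =
     mat2 (v t (monom 1 (2 * n))) (w t (monom 1 (2 * n)))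
       (v t (monom 1 (2 * n + 1)) - a t 1 * v t (monom 1 (2 * n)))
       (w t (monom 1 (2 * n + 1)) - a t 1 * w t (monom 1 (2 * n)))"
proof -
  have idx: "2 * 1 = (2::nat)" "2 - 1 = (1::nat)" by simp_all
  have "monom 1 (2 * n) * p t 2 = monom 1 (2 * n + 1) - smult (a t 1) (monom 1 (2 * n))"
    unfolding p2 by (simp add: right_diff_distrib mult_monom)
  then show ?thesis
    unfolding imat_block_def idx J_power [of 1, OF order.refl] J_power [of 2, OF one_le_numeral]
    by (simp only: p_simps(3) mult_1_right plinear_simps [OF v_linear] plinear_simps [OF w_linear])
qed

lemma J_block:
  "imat_block (Jm t) 1 1 = mat2 (b t 1) (a t 2) (c t 1) (b t 2)"
  "imat_block (imat_lower (Jm t)) 1 1 = mat2 0 0 (c t 1) 0"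
  by (simp_all add: imat_block_def imat_lower_def Jmat_def numeral_2_eq_2)

lemma shifted_derivative_iff:
  assumes "(f has_vector_derivative f') (at t)"
  shows "((\<lambda>s. g s - a s 1 * f s) has_vector_derivative g' - (a t 1 * f' + c t 1 * f t)) (at t) \<longleftrightarrow>
    (g has_vector_derivative g') (at t)"
proof -
  have m: "((\<lambda>s. a s 1 * f s) has_vector_derivative a t 1 * f' + c t 1 * f t) (at t)"
    using has_vector_derivative_mult [OF a' [of 1 t] assms] unfolding a1 .
  show ?thesis
    using has_vector_derivative_add [OF _ m, of "\<lambda>s. g s - a s 1 * f s" "g' - (a t 1 * f' + c t 1 * f t)"]
      has_vector_derivative_diff [OF _ m, of g g'] by auto
qed

text \<open>\<open>J_11 - (J_-)_11\<close> is the upper triangular matrix of \<open>b_1\<close>,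
  \<open>a_2\<close>, \<open>b_2\<close> in the evolution law. The last term of (b) comes from the
  second row, where \<open>p 2 = x - a_1\<close> moves at the rate \<open>- c_1\<close>.\<close>

lemma block_power_evolution_iff: "block_power_evolution Jm \<longleftrightarrow> (\<forall>t k. evolves t (monom 1 k))"
proof -
  have "block_power_evolution Jm \<longleftrightarrow> (\<forall>t n. evolves t (monom 1 (2 * n)) \<and> evolves t (monom 1 (2 * n + 1)))"
  proof -
    have "((\<lambda>s. imat_block (imat_power (Jm s) n) 1 1) has_vector_derivative
        imat_block (imat_power (Jm t) (n + 1)) 1 1
        - imat_block (imat_power (Jm t) n) 1 1 ** imat_block (Jm t) 1 1
        + imat_block (imat_power (Jm t) n) 1 1 ** imat_block (imat_lower (Jm t)) 1 1
        - imat_block (imat_lower (Jm t)) 1 1 ** imat_block (imat_power (Jm t) n) 1 1) (at t)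
      \<longleftrightarrow> evolves t (monom 1 (2 * n)) \<and> evolves t (monom 1 (2 * n + 1))" (is "?L \<longleftrightarrow> _") for t n
    proof -
      let ?v = "\<lambda>s. v s (monom 1 (2 * n))" and ?w = "\<lambda>s. w s (monom 1 (2 * n))"
      let ?vo = "\<lambda>s. v s (monom 1 (2 * n + 1))" and ?wo = "\<lambda>s. w s (monom 1 (2 * n + 1))"
      let ?v2 = "v t (monom 1 (2 * n + 2))" and ?w2 = "w t (monom 1 (2 * n + 2))"
      let ?vo2 = "v t (monom 1 (2 * n + 3))" and ?wo2 = "w t (monom 1 (2 * n + 3))"
      let ?dv = "?v2 - b t 1 * ?v t" and ?dw = "?w2 - a t 2 * ?v t - b t 2 * ?w t"
      let ?dvo = "?vo2 - b t 1 * ?vo t" and ?dwo = "?wo2 - a t 2 * ?vo t - b t 2 * ?wo t"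
      have idx: "2 * (n + 1) = 2 * n + 2" "2 * n + 2 + 1 = 2 * n + 3" by simp_all
      have "imat_block (imat_power (Jm t) (n + 1)) 1 1
        - imat_block (imat_power (Jm t) n) 1 1 ** imat_block (Jm t) 1 1
        + imat_block (imat_power (Jm t) n) 1 1 ** imat_block (imat_lower (Jm t)) 1 1
        - imat_block (imat_lower (Jm t)) 1 1 ** imat_block (imat_power (Jm t) n) 1 1
        = mat2 ?dv ?dw (?dvo - (a t 1 * ?dv + c t 1 * ?v t)) (?dwo - (a t 1 * ?dw + c t 1 * ?w t))"
        unfolding J_power_block J_block mat2_mult mat2_add mat2_diff idx by (rule mat2_cong; algebra)
      then have "?L \<longleftrightarrow> (?v has_vector_derivative ?dv) (at t) \<and> (?w has_vector_derivative ?dw) (at t) \<and>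
         ((\<lambda>s. ?vo s - a s 1 * ?v s) has_vector_derivative ?dvo - (a t 1 * ?dv + c t 1 * ?v t)) (at t) \<and>
         ((\<lambda>s. ?wo s - a s 1 * ?w s) has_vector_derivative ?dwo - (a t 1 * ?dw + c t 1 * ?w t)) (at t)"
        by (simp only: J_power_block has_vector_derivative_mat2_iff)
      moreover have "evolves t (monom 1 (2 * n)) \<longleftrightarrow>
          (?v has_vector_derivative ?dv) (at t) \<and> (?w has_vector_derivative ?dw) (at t)"
        "evolves t (monom 1 (2 * n + 1)) \<longleftrightarrow>
          (?vo has_vector_derivative ?dvo) (at t) \<and> (?wo has_vector_derivative ?dwo) (at t)"
        by (simp_all add: evolves_def mult_monom numeral_3_eq_3)
      moreover note shifted_derivative_iff [of ?v ?dv t ?vo ?dvo] shifted_derivative_iff [of ?w ?dw t ?wo ?dwo]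
      ultimately show ?thesis
        by argo
    qed
    then show ?thesis
      unfolding block_power_evolution_def by blast
  qed
  also have "\<dots> \<longleftrightarrow> (\<forall>t k. evolves t (monom 1 k))"
  proof
    assume *: "\<forall>t n. evolves t (monom 1 (2 * n)) \<and> evolves t (monom 1 (2 * n + 1))"
    show "\<forall>t k. evolves t (monom 1 k)"
    proof (intro allI)
      fix t and k :: nat
      have "k = 2 * (k div 2) \<or> k = 2 * (k div 2) + 1" by presburger
      then show "evolves t (monom 1 k)" using * by metis
    qed
  qed auto
  finally show ?thesis .
qed

end

section \<open>Bounds for powers of the matrix\<close>

lemma ell2_finite_sum_le:
  assumes "x \<in> ell2" "finite F" "F \<subseteq> {1..}"
  shows "(\<Sum>i\<in>F. (cmod (x i))\<^sup>2) \<le> (ell2_norm x)\<^sup>2"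
proof -
  have "(ell2_norm x)\<^sup>2 = (\<Sum>\<^sub>\<infinity>i\<in>{1..}. (cmod (x i))\<^sup>2)"
    unfolding ell2_norm_def by (simp add: infsum_nonneg)
  then show ?thesis
    using assms finite_sum_le_infsum [of "\<lambda>i. (cmod (x i))\<^sup>2" "{1..}" F] by (simp add: ell2_def)
qed

lemma ell2_normI:
  assumes "\<And>F. finite F \<Longrightarrow> F \<subseteq> {1..} \<Longrightarrow> (\<Sum>i\<in>F. (cmod (x i))\<^sup>2) \<le> B\<^sup>2" "B \<ge> 0"
  shows "x \<in> ell2" "ell2_norm x \<le> B"
proof -
  have s: "(\<lambda>i. (cmod (x i))\<^sup>2) summable_on {1..}"
    using assms(1) by (intro nonneg_bdd_above_summable_on bdd_aboveI2) auto
  then show "x \<in> ell2" by (simp add: ell2_def)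
  have "(\<Sum>\<^sub>\<infinity>i\<in>{1..}. (cmod (x i))\<^sup>2) \<le> B\<^sup>2"
    using s assms(1) by (rule infsum_le_finite_sums)
  then show "ell2_norm x \<le> B"
    unfolding ell2_norm_def using assms(2) real_le_lsqrt by blast
qed

lemma ell2_norm_nonneg: "ell2_norm x \<ge> 0"
  by (simp add: ell2_norm_def infsum_nonneg)

lemma cmod_le_ell2_norm:
  assumes "x \<in> ell2" "i \<ge> 1"
  shows "cmod (x i) \<le> ell2_norm x"
  using ell2_finite_sum_le [of x "{i}"] assms ell2_norm_nonneg [of x]
  by (simp add: power2_le_iff_abs_le)

lemma ell2_scale:
  assumes "x \<in> ell2"
  shows "(\<lambda>i. z * x i) \<in> ell2" "ell2_norm (\<lambda>i. z * x i) = cmod z * ell2_norm x"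
proof -
  show "(\<lambda>i. z * x i) \<in> ell2"
    using assms by (simp add: ell2_def norm_mult power_mult_distrib summable_on_cmult_right)
  show "ell2_norm (\<lambda>i. z * x i) = cmod z * ell2_norm x"
    by (simp add: ell2_norm_def norm_mult power_mult_distrib infsum_cmult_right' real_sqrt_mult)
qed

lemma imat_apply_scale: "imat_apply X (\<lambda>i. z * x i) = (\<lambda>i. z * imat_apply X x i)"
proof
  fix i
  have "imat_apply X (\<lambda>i. z * x i) i = (\<Sum>\<^sub>\<infinity>j\<in>{1..}. z * (X i j * x j))"
    unfolding imat_apply_def by (simp add: mult.left_commute)
  then show "imat_apply X (\<lambda>i. z * x i) i = z * imat_apply X x i"
    by (simp add: imat_apply_def infsum_cmult_right')
qed

lemma sum_5_squares_le:
  fixes x1 x2 x3 x4 x5 :: real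
  shows "(x1 + x2 + x3 + x4 + x5)\<^sup>2 \<le> 5 * (x1\<^sup>2 + x2\<^sup>2 + x3\<^sup>2 + x4\<^sup>2 + x5\<^sup>2)"
proof -
  have "0 \<le> (x1 - x2)\<^sup>2 + (x1 - x3)\<^sup>2 + (x1 - x4)\<^sup>2 + (x1 - x5)\<^sup>2 + (x2 - x3)\<^sup>2 + (x2 - x4)\<^sup>2
      + (x2 - x5)\<^sup>2 + (x3 - x4)\<^sup>2 + (x3 - x5)\<^sup>2 + (x4 - x5)\<^sup>2"
    by simp
  then show ?thesis
    by (simp add: power2_eq_square algebra_simps)
qed

text \<open>The condition \<open>K \<ge> 1\<close> lets \<open>K\<close> bound the entries 1 of the
  second superdiagonal too.\<close>

locale bounded_coefficients =
  fixes a b c d :: cseq and K :: real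
  assumes zero: "c 0 = 0" "d 0 = 0"
    and K: "K \<ge> 1" "\<And>n. n \<ge> 1 \<Longrightarrow> cmod (a n) \<le> K" "\<And>n. n \<ge> 1 \<Longrightarrow> cmod (b n) \<le> K"
      "\<And>n. n \<ge> 1 \<Longrightarrow> cmod (c n) \<le> K" "\<And>n. n \<ge> 1 \<Longrightarrow> cmod (d n) \<le> K"
begin

abbreviation "A \<equiv> Jmat a b c d"

text \<open>The five bands are shifts with weights at most \<open>K\<close>. Squaring a sum of five
  terms costs a factor 5, and adding the five shifted norms another, which makes
  \<open>25 * K^2\<close> in the square.\<close>

lemma apply_bound:
  assumes x: "x \<in> ell2"
  shows "imat_apply A x \<in> ell2" "ell2_norm (imat_apply A x) \<le> 5 * K * ell2_norm x"
proof -
  define X where "X i = (if i = 0 then 0 else cmod (x i))" for i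
  have X0: "X i \<ge> 0" for i by (simp add: X_def)
  have entry: "cmod (imat_apply A x i) \<le> K * (X (i + 2) + X (i + 1) + X i + X (i - 1) + X (i - 2))"
    if i: "i \<ge> 1" for i
  proof -
    have "cmod (imat_apply A x i) \<le> cmod (x (i + 2)) + cmod (a (i + 1) * x (i + 1)) + cmod (b i * x i)
       + cmod (c (i - 1) * x (i - 1)) + cmod (d (i - 2) * x (i - 2))"
      unfolding imat_apply_def Jmat_infsum [of c d i a b, OF zero i]
      by (intro norm_triangle_le add_mono) auto
    moreover have "cmod (x (i + 2)) \<le> K * X (i + 2)"
      using mult_right_mono [OF K(1), of "cmod (x (i + 2))"] by (simp add: X_def)
    moreover have "cmod (a (i + 1) * x (i + 1)) \<le> K * X (i + 1)" "cmod (b i * x i) \<le> K * X i"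
      using i by (auto simp: X_def norm_mult intro!: mult_right_mono K)
    moreover have "cmod (c (i - 1) * x (i - 1)) \<le> K * X (i - 1)"
      by (cases "i - 1 = 0") (auto simp: X_def norm_mult zero intro!: mult_right_mono K)
    moreover have "cmod (d (i - 2) * x (i - 2)) \<le> K * X (i - 2)"
      by (cases "i - 2 = 0") (auto simp: X_def norm_mult zero intro!: mult_right_mono K)
    ultimately show ?thesis
      by (simp add: distrib_left)
  qed
  \<comment> \<open>Injectivity is asked where \<open>h i \<ge> 1\<close>, because truncated
    subtraction sends several indices to 0; there \<open>X\<close> is 0.\<close>
  have shift: "(\<Sum>i\<in>F. (X (h i))\<^sup>2) \<le> (ell2_norm x)\<^sup>2"
    if F: "finite F" "inj_on h {i\<in>F. h i \<ge> 1}" for F and h :: "nat \<Rightarrow> nat"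
  proof -
    have "(\<Sum>i\<in>F. (X (h i))\<^sup>2) = (\<Sum>i\<in>{i\<in>F. h i \<ge> 1}. (cmod (x (h i)))\<^sup>2)"
      using F(1) by (intro sum.mono_neutral_cong_right) (auto simp: X_def)
    also have "\<dots> = (\<Sum>i\<in>h ` {i\<in>F. h i \<ge> 1}. (cmod (x i))\<^sup>2)"
      using F(2) by (simp add: sum.reindex)
    also have "\<dots> \<le> (ell2_norm x)\<^sup>2"
      using F(1) by (intro ell2_finite_sum_le [OF x]) auto
    finally show ?thesis .
  qed
  have "(\<Sum>i\<in>F. (cmod (imat_apply A x i))\<^sup>2) \<le> (5 * K * ell2_norm x)\<^sup>2"
    if F: "finite F" "F \<subseteq> {1..}" for F
  proof -
    have "(\<Sum>i\<in>F. (cmod (imat_apply A x i))\<^sup>2)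
        \<le> (\<Sum>i\<in>F. K\<^sup>2 * (5 * ((X (i + 2))\<^sup>2 + (X (i + 1))\<^sup>2 + (X i)\<^sup>2 + (X (i - 1))\<^sup>2 + (X (i - 2))\<^sup>2)))"
    proof (rule sum_mono)
      fix i assume "i \<in> F"
      then have "cmod (imat_apply A x i) \<le> K * (X (i + 2) + X (i + 1) + X i + X (i - 1) + X (i - 2))"
        using F(2) by (intro entry) auto
      then have "(cmod (imat_apply A x i))\<^sup>2 \<le> (K * (X (i + 2) + X (i + 1) + X i + X (i - 1) + X (i - 2)))\<^sup>2"
        by (rule power_mono) simp
      also have "\<dots> \<le> K\<^sup>2 * (5 * ((X (i + 2))\<^sup>2 + (X (i + 1))\<^sup>2 + (X i)\<^sup>2 + (X (i - 1))\<^sup>2 + (X (i - 2))\<^sup>2))"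
        unfolding power_mult_distrib by (intro mult_left_mono sum_5_squares_le) simp
      finally show "(cmod (imat_apply A x i))\<^sup>2
        \<le> K\<^sup>2 * (5 * ((X (i + 2))\<^sup>2 + (X (i + 1))\<^sup>2 + (X i)\<^sup>2 + (X (i - 1))\<^sup>2 + (X (i - 2))\<^sup>2))" .
    qed
    also have "\<dots> = K\<^sup>2 * (5 * ((\<Sum>i\<in>F. (X (i + 2))\<^sup>2) + (\<Sum>i\<in>F. (X (i + 1))\<^sup>2) + (\<Sum>i\<in>F. (X i)\<^sup>2)
        + (\<Sum>i\<in>F. (X (i - 1))\<^sup>2) + (\<Sum>i\<in>F. (X (i - 2))\<^sup>2)))"
      by (simp add: sum_distrib_left [symmetric] sum.distrib)
    also have "\<dots> \<le> K\<^sup>2 * (5 * ((ell2_norm x)\<^sup>2 + (ell2_norm x)\<^sup>2 + (ell2_norm x)\<^sup>2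
        + (ell2_norm x)\<^sup>2 + (ell2_norm x)\<^sup>2))"
      by (intro mult_left_mono add_mono shift F(1)) (auto simp: inj_on_def)
    also have "\<dots> = (5 * K * ell2_norm x)\<^sup>2"
      by (simp add: power_mult_distrib)
    finally show ?thesis .
  qed
  moreover have "5 * K * ell2_norm x \<ge> 0"
    using K(1) by (simp add: ell2_norm_nonneg)
  ultimately show "imat_apply A x \<in> ell2" "ell2_norm (imat_apply A x) \<le> 5 * K * ell2_norm x"
    using ell2_normI [of "imat_apply A x" "5 * K * ell2_norm x"] by blast+
qed

lemma norm_set_bdd: "bdd_above ((\<lambda>x. ell2_norm (imat_apply A x)) ` {x \<in> ell2. ell2_norm x \<le> 1})"
proof (rule bdd_aboveI2)
  fix x assume "x \<in> {x \<in> ell2. ell2_norm x \<le> 1}"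
  then have x: "x \<in> ell2" "ell2_norm x \<le> 1" by auto
  have "5 * K * ell2_norm x \<le> 5 * K * 1"
    using K(1) x(2) by (intro mult_left_mono) auto
  then show "ell2_norm (imat_apply A x) \<le> 5 * K"
    using apply_bound(2) [OF x(1)] by simp
qed

lemma zero_ell2: "(\<lambda>i. 0) \<in> ell2" "ell2_norm (\<lambda>i. 0) = 0"
  by (simp_all add: ell2_def ell2_norm_def)

lemma imat_norm_le: "imat_norm A \<le> 5 * K"
  unfolding imat_norm_def
proof (rule cSUP_least)
  show "{x \<in> ell2. ell2_norm x \<le> 1} \<noteq> {}"
    using zero_ell2 by force
  fix x assume "x \<in> {x \<in> ell2. ell2_norm x \<le> 1}"
  then have x: "x \<in> ell2" "ell2_norm x \<le> 1" by auto
  have "5 * K * ell2_norm x \<le> 5 * K * 1"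
    using K(1) x(2) by (intro mult_left_mono) auto
  then show "ell2_norm (imat_apply A x) \<le> 5 * K"
    using apply_bound(2) [OF x(1)] by simp
qed

lemma imat_norm_nonneg: "imat_norm A \<ge> 0"
proof -
  have "ell2_norm (imat_apply A (\<lambda>i. 0)) \<le> imat_norm A"
    unfolding imat_norm_def using zero_ell2 by (intro cSUP_upper norm_set_bdd) auto
  then show ?thesis
    using ell2_norm_nonneg order_trans by blast
qed

lemma apply_le_imat_norm:
  assumes x: "x \<in> ell2"
  shows "ell2_norm (imat_apply A x) \<le> imat_norm A * ell2_norm x"
proof (cases "ell2_norm x = 0")
  case True
  then show ?thesis using apply_bound(2) [OF x] by simp
next
  case False
  define r where "r = ell2_norm x"
  have r: "r > 0" using False ell2_norm_nonneg [of x] by (simp add: r_def)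
  define z where "z = complex_of_real (1 / r)"
  have z: "cmod z = 1 / r" using r by (simp add: z_def norm_divide)
  have "ell2_norm (\<lambda>i. z * x i) = 1"
    unfolding ell2_scale(2) [OF x] z using r by (simp add: r_def)
  then have "ell2_norm (imat_apply A (\<lambda>i. z * x i)) \<le> imat_norm A"
    unfolding imat_norm_def by (intro cSUP_upper norm_set_bdd) (simp add: ell2_scale(1) [OF x])
  then have "1 / r * ell2_norm (imat_apply A x) \<le> imat_norm A"
    unfolding imat_apply_scale ell2_scale(2) [OF apply_bound(1) [OF x]] z .
  then show ?thesis
    using r by (simp add: r_def field_simps)
qed

text \<open>Column \<open>j\<close> of a power arises by applying \<open>J\<close> to column
  \<open>j\<close> of the preceding power, so the operator norm bounds columns, and through them
  single entries.\<close>

lemma power_column: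
  assumes "j \<ge> 1"
  shows "(\<lambda>i. imat_power A n i j) \<in> ell2 \<and> ell2_norm (\<lambda>i. imat_power A n i j) \<le> imat_norm A ^ n"
proof (induction n)
  case 0
  let ?x = "\<lambda>i. imat_power A 0 i j"
  have s: "(\<Sum>i\<in>F. (cmod (?x i))\<^sup>2) \<le> 1\<^sup>2" if "finite F" for F
  proof -
    have "(\<Sum>i\<in>F. (cmod (?x i))\<^sup>2) = (\<Sum>i\<in>F. if i = j then 1 else 0)"
      by (rule sum.cong) auto
    then show ?thesis using that by simp
  qed
  show ?case
    using ell2_normI [of ?x 1, OF s] by simp
next
  case (Suc n)
  have e: "(\<lambda>i. imat_power A (Suc n) i j) = imat_apply A (\<lambda>k. imat_power A n k j)"
    by (simp add: imat_mult_def imat_apply_def)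
  have "ell2_norm (imat_apply A (\<lambda>k. imat_power A n k j)) \<le> imat_norm A * ell2_norm (\<lambda>k. imat_power A n k j)"
    using Suc by (intro apply_le_imat_norm) blast
  also have "\<dots> \<le> imat_norm A * imat_norm A ^ n"
    using Suc imat_norm_nonneg by (intro mult_left_mono) auto
  finally show ?case
    unfolding e using apply_bound(1) Suc by simp
qed

lemma power_entry_le: "i \<ge> 1 \<Longrightarrow> j \<ge> 1 \<Longrightarrow> cmod (imat_power A n i j) \<le> imat_norm A ^ n"
  using power_column [of j n] cmod_le_ell2_norm [of "\<lambda>i. imat_power A n i j" i] by linarith

end

section \<open>Series in inverse powers\<close>

lemma summable_inverse_powers:
  fixes w :: "nat \<Rightarrow> complex"
  assumes "0 \<le> R" "cmod z > R" and w: "\<And>n. cmod (w n) \<le> C * R ^ n"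
  shows "summable (\<lambda>n. C * R ^ n / cmod z ^ (n + 1))"
    and "cmod (w n / z ^ (n + 1)) \<le> C * R ^ n / cmod z ^ (n + 1)"
    and "summable (\<lambda>n. w n / z ^ (n + 1))"
proof -
  have z: "cmod z > 0" using assms by linarith
  have "summable (\<lambda>n. (C / cmod z) * (R / cmod z) ^ n)"
    using assms z by (intro summable_mult summable_geometric) simp
  then show s: "summable (\<lambda>n. C * R ^ n / cmod z ^ (n + 1))"
    by (simp add: power_divide)
  show b: "cmod (w n / z ^ (n + 1)) \<le> C * R ^ n / cmod z ^ (n + 1)" for n
    unfolding norm_divide norm_power using w z by (intro divide_right_mono) auto
  show "summable (\<lambda>n. w n / z ^ (n + 1))"
    using s b by (rule summable_comparison_test' [where N = 0])
qed

text \<open>The Weierstrass test makes the series of derivatives converge uniformly in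
  \<open>s\<close>; convergence of the series itself is asked at one point. In this form it applies
  to antiderivatives of unknown size.\<close>

lemma termwise_derivative:
  fixes f g :: "nat \<Rightarrow> real \<Rightarrow> complex"
  assumes R: "0 \<le> R" "cmod z > R" and g: "\<And>n s. cmod (g n s) \<le> C * R ^ n"
    and f: "\<And>n s. (f n has_vector_derivative g n s) (at s)"
    and s0: "summable (\<lambda>n. f n s0 / z ^ (n + 1))"
  shows "summable (\<lambda>n. f n t / z ^ (n + 1))"
    and "((\<lambda>s. \<Sum>n. f n s / z ^ (n + 1)) has_vector_derivative (\<Sum>n. g n t / z ^ (n + 1))) (at t)"
proof -
  let ?G = "\<lambda>s. \<Sum>n. g n s / z ^ (n + 1)"
  have lim: "uniform_limit UNIV (\<lambda>N s. \<Sum>n<N. g n s / z ^ (n + 1)) ?G sequentially"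
    using summable_inverse_powers [OF R g] by (intro Weierstrass_m_test) auto
  have "\<exists>h. \<forall>s\<in>UNIV. (\<lambda>n. f n s / z ^ (n + 1)) sums h s \<and>
      (h has_derivative (\<lambda>r. r *\<^sub>R ?G s)) (at s within UNIV)"
  proof (rule has_derivative_series [where f' = "\<lambda>n s r. r *\<^sub>R (g n s / z ^ (n + 1))" and x = s0
        and l = "\<Sum>n. f n s0 / z ^ (n + 1)"])
    show "((\<lambda>s. f n s / z ^ (n + 1)) has_derivative (\<lambda>r. r *\<^sub>R (g n s / z ^ (n + 1)))) (at s within UNIV)" for n s
      using has_vector_derivative_divide [OF f] by (simp add: has_vector_derivative_def)
    show "\<forall>\<^sub>F N in sequentially. \<forall>s\<in>UNIV. \<forall>r. norm ((\<Sum>n<N. r *\<^sub>R (g n s / z ^ (n + 1))) - r *\<^sub>R ?G s) \<le> e * norm r"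
      if "e > 0" for e
    proof -
      have "\<forall>\<^sub>F N in sequentially. \<forall>s\<in>UNIV. dist (\<Sum>n<N. g n s / z ^ (n + 1)) (?G s) < e"
        using lim that by (simp add: uniform_limit_iff)
      then show ?thesis
      proof (rule eventually_mono, intro ballI allI)
        fix N s and r :: real
        assume *: "\<forall>s\<in>UNIV. dist (\<Sum>n<N. g n s / z ^ (n + 1)) (?G s) < e"
        have "norm ((\<Sum>n<N. r *\<^sub>R (g n s / z ^ (n + 1))) - r *\<^sub>R ?G s)
          = \<bar>r\<bar> * norm ((\<Sum>n<N. g n s / z ^ (n + 1)) - ?G s)"
          by (simp only: scaleR_right.sum [symmetric] scaleR_diff_right [symmetric] norm_scaleR)
        also have "\<dots> \<le> \<bar>r\<bar> * e"
          using * by (intro mult_left_mono) (auto simp: dist_norm less_imp_le)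
        finally show "norm ((\<Sum>n<N. r *\<^sub>R (g n s / z ^ (n + 1))) - r *\<^sub>R ?G s) \<le> e * norm r"
          by (simp add: mult.commute)
      qed
    qed
  qed (use s0 in \<open>auto simp: summable_sums\<close>)
  then obtain h where h: "\<And>s. (\<lambda>n. f n s / z ^ (n + 1)) sums h s"
      "\<And>s. (h has_vector_derivative ?G s) (at s)"
    unfolding has_vector_derivative_def by auto
  show "summable (\<lambda>n. f n t / z ^ (n + 1))"
    using h(1) by (rule sums_summable)
  have "h = (\<lambda>s. \<Sum>n. f n s / z ^ (n + 1))"
    using h(1) by (auto simp: sums_iff)
  then show "((\<lambda>s. \<Sum>n. f n s / z ^ (n + 1)) has_vector_derivative ?G t) (at t)"
    using h(2) by simp
qed

text \<open>Termwise differentiation gives one direction. In the other, \<open>f n\<close> is not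
  known to be differentiable; therefore \<open>g n\<close> is integrated to \<open>Q n\<close> with
  \<open>Q n 0 = f n 0\<close>. The series of \<open>Q\<close> and \<open>f\<close> share derivative
  and initial value, hence agree for every \<open>z\<close>, and comparison of coefficients yields
  \<open>Q n = f n\<close>.\<close>

lemma series_evolution_iff:
  fixes f g :: "nat \<Rightarrow> real \<Rightarrow> complex"
  assumes R: "0 \<le> R" and f: "\<And>n s. cmod (f n s) \<le> C * R ^ n" and g: "\<And>n s. cmod (g n s) \<le> D * R ^ n"
    and cont: "\<And>n s. isCont (g n) s"
  shows "(\<forall>t z. cmod z > R \<longrightarrow>
      ((\<lambda>s. \<Sum>n. f n s / z ^ (n + 1)) has_vector_derivative (\<Sum>n. g n t / z ^ (n + 1))) (at t)) \<longleftrightarrow>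
    (\<forall>t n. (f n has_vector_derivative g n t) (at t))"
proof
  assume "\<forall>t n. (f n has_vector_derivative g n t) (at t)"
  then have der: "(f n has_vector_derivative g n t) (at t)" for n t by blast
  show "\<forall>t z. cmod z > R \<longrightarrow>
      ((\<lambda>s. \<Sum>n. f n s / z ^ (n + 1)) has_vector_derivative (\<Sum>n. g n t / z ^ (n + 1))) (at t)"
  proof (intro allI impI)
    fix t z
    assume z: "cmod z > R"
    have "summable (\<lambda>n. f n 0 / z ^ (n + 1))"
      using R z f by (rule summable_inverse_powers(3))
    then show "((\<lambda>s. \<Sum>n. f n s / z ^ (n + 1)) has_vector_derivative (\<Sum>n. g n t / z ^ (n + 1))) (at t)"
      by (rule termwise_derivative(2) [OF R z g der])
  qed
next
  assume ev: "\<forall>t z. cmod z > R \<longrightarrow>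
      ((\<lambda>s. \<Sum>n. f n s / z ^ (n + 1)) has_vector_derivative (\<Sum>n. g n t / z ^ (n + 1))) (at t)"
  have "\<exists>F. \<forall>s. (F has_vector_derivative g n s) (at s)" for n
    using einterval_antiderivative [of "-\<infinity>" "\<infinity>" "g n"] cont by auto
  then obtain F where F: "\<And>n s. (F n has_vector_derivative g n s) (at s)"
    by metis
  define Q where "Q n s = F n s + (f n 0 - F n 0)" for n s
  have Q: "(Q n has_vector_derivative g n s) (at s)" for n s
    using has_vector_derivative_add [OF F [of n s] has_vector_derivative_const [of "f n 0 - F n 0"]]
    by (simp add: Q_def [abs_def])
  have Q0: "Q n 0 = f n 0" for n by (simp add: Q_def)
  have sums: "(\<lambda>n. (Q n s - f n s) / z ^ (n + 1)) sums 0" if z: "cmod z > R" for z s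
  proof -
    have sf: "summable (\<lambda>n. f n s / z ^ (n + 1))" for s
      using summable_inverse_powers(3) [OF R z f] .
    have Qs: "summable (\<lambda>n. Q n s / z ^ (n + 1))"
      "((\<lambda>s. \<Sum>n. Q n s / z ^ (n + 1)) has_vector_derivative (\<Sum>n. g n s / z ^ (n + 1))) (at s)" for s
      using termwise_derivative [OF R z g Q, of 0] sf [of 0] by (simp_all add: Q0)
    define h where "h s = (\<Sum>n. Q n s / z ^ (n + 1)) - (\<Sum>n. f n s / z ^ (n + 1))" for s
    have "(h has_vector_derivative 0) (at s)" for s
      using has_vector_derivative_diff [OF Qs(2) ev [rule_format, OF z], of s]
      by (simp add: h_def [abs_def])
    then obtain k where "\<And>s. h s = k"
      using has_vector_derivative_zero_constant [of UNIV h] by auto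
    moreover have "h 0 = 0" by (simp add: h_def Q0)
    ultimately have "h s = 0" by metis
    moreover have "(\<lambda>n. Q n s / z ^ (n + 1) - f n s / z ^ (n + 1)) sums h s"
      unfolding h_def by (intro sums_diff summable_sums Qs(1) sf)
    ultimately show ?thesis
      by (simp add: diff_divide_distrib)
  qed
  have "Q n s - f n s = 0" for n s
  \<comment> \<open>The substitution is \<open>y = 1 / z\<close>; the radius
    \<open>1 / (R + 1)\<close> also makes sense for \<open>R = 0\<close>.\<close>
  proof (rule powser_coeffs_zero [of "1 / (R + 1)" "\<lambda>n. Q n s - f n s"])
    show "0 < 1 / (R + 1)" using R by simp
    fix y :: complex
    assume y: "y \<noteq> 0" "norm y < 1 / (R + 1)"
    have "cmod y + R * cmod y < 1"
      using y R by (simp add: field_simps)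
    then have "R * cmod y < 1"
      by (rule le_less_trans [rotated]) simp
    then have "R < 1 / cmod y" using y by (simp add: field_simps)
    then have "cmod (1 / y) > R" by (simp add: norm_divide)
    from sums_mult [OF sums [OF this, of s], of "1 / y"]
    show "(\<lambda>n. (Q n s - f n s) * y ^ n) sums 0"
      using y by (simp add: power_divide)
  qed
  then have "Q n = f n" for n by (simp add: fun_eq_iff)
  then show "\<forall>t n. (f n has_vector_derivative g n t) (at t)"
    using Q by metis
qed

section \<open>The generalized Markov function\<close>

locale bounded_flow = flow_functional +
  fixes K :: real
  assumes bounded: "bounded_coefficients (a t) (b t) (c t) (d t) K"
begin

definition R :: real where
  "R = (SUP s. imat_norm (Jm s))"

lemma imat_norm_le_R: "imat_norm (Jm t) \<le> R"
  unfolding R_def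
proof (rule cSUP_upper)
  show "bdd_above (range (\<lambda>s. imat_norm (Jm s)))"
    using bounded_coefficients.imat_norm_le [OF bounded] by (intro bdd_aboveI2)
qed simp

lemma imat_norm_nonneg: "0 \<le> imat_norm (Jm t)"
  using bounded_coefficients.imat_norm_nonneg [OF bounded] .

lemma R_nonneg: "0 \<le> R"
  using imat_norm_le_R imat_norm_nonneg order_trans by blast

lemma power_entry_bound:
  assumes "i \<ge> 1" "j \<ge> 1"
  shows "cmod (imat_power (Jm t) n i j) \<le> R ^ n"
  using bounded_coefficients.power_entry_le [OF bounded assms] power_mono [OF imat_norm_le_R imat_norm_nonneg]
    order_trans by blast

text \<open>The entries of the first block of \<open>J^n\<close> are at most \<open>R ^ n\<close>.
  One factor \<open>1 + K\<close> pays for writing \<open>x\<close> as \<open>p 2 + a_1\<close>, the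
  other for \<open>u^1 = v - a_1 w\<close>.\<close>

lemma moment_bound: "cmod ((U t $ j) (monom 1 (2 * n + l))) \<le> (1 + K) * (1 + K) * R ^ n" if "l < 2"
proof -
  have K: "K \<ge> 1" "cmod (a t 1) \<le> K"
    using bounded [of t] by (simp_all add: bounded_coefficients_def)
  have shift: "cmod (y + a t 1 * x) \<le> (1 + K) * B" "cmod (y - a t 1 * x) \<le> (1 + K) * B"
    if "cmod x \<le> B" "cmod y \<le> B" for x y B
  proof -
    have "cmod (a t 1 * x) \<le> K * B"
      unfolding norm_mult using K that by (intro mult_mono) auto
    then show "cmod (y + a t 1 * x) \<le> (1 + K) * B" "cmod (y - a t 1 * x) \<le> (1 + K) * B"
      using that(2) norm_triangle_ineq [of y "a t 1 * x"] norm_triangle_ineq4 [of y "a t 1 * x"]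
      by (auto simp: distrib_right)
  qed
  have Rn: "R ^ n \<ge> 0" using R_nonneg by simp
  have le: "R ^ n \<le> (1 + K) * R ^ n"
    using K(1) Rn mult_right_mono [of 1 "1 + K" "R ^ n"] by simp
  have p1: "monom 1 (2 * n) * p t 1 = monom 1 (2 * n)"
    by simp
  have p2': "monom 1 (2 * n + 1) = monom 1 (2 * n) * p t 2 + smult (a t 1) (monom 1 (2 * n))"
    unfolding p2 by (simp add: right_diff_distrib mult_monom)
  note e1 = J_power [of 1, OF order.refl, of t n, unfolded p1] and e2 = J_power [of 2, OF one_le_numeral, of t n]
  have "cmod (v t (monom 1 (2 * n))) \<le> R ^ n" "cmod (w t (monom 1 (2 * n))) \<le> R ^ n"
    "cmod (v t (monom 1 (2 * n) * p t 2)) \<le> R ^ n" "cmod (w t (monom 1 (2 * n) * p t 2)) \<le> R ^ n"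
    using power_entry_bound [of 1 1 t n] power_entry_bound [of 1 2 t n]
      power_entry_bound [of 2 1 t n] power_entry_bound [of 2 2 t n] unfolding e1 e2 by simp_all
  then have 0: "cmod (v t (monom 1 (2 * n + l))) \<le> (1 + K) * R ^ n"
     "cmod (w t (monom 1 (2 * n + l))) \<le> (1 + K) * R ^ n"
    using that le shift(1) [of "v t (monom 1 (2 * n))" "R ^ n" "v t (monom 1 (2 * n) * p t 2)"]
      shift(1) [of "w t (monom 1 (2 * n))" "R ^ n" "w t (monom 1 (2 * n) * p t 2)"]
    unfolding less_2_cases_iff
    by (auto simp: p2' [simplified] plinear_simps [OF v_linear] plinear_simps [OF w_linear])
  have u: "(U t $ 1) P = v t P - a t 1 * w t P" "(U t $ 2) P = w t P" for P
    by (simp_all add: v_def w_def)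
  have "(1 + K) * R ^ n \<le> (1 + K) * ((1 + K) * R ^ n)"
    using K(1) le by (intro mult_left_mono) auto
  then show ?thesis
    using shift(2) [OF 0(2) 0(1)] 0(2) exhaust_2 [of j] by (auto simp: u mult.assoc)
qed

text \<open>For \<open>k \<ge> 2\<close> the functionals vanish at \<open>p (k + 1)\<close>, which
  expresses their values at \<open>x^k\<close> through lower monomials and the coefficients of
  \<open>p\<close>, differentiable in time. Continuity is what allows \<open>rate\<close> to be
  integrated.\<close>

lemma continuous_u: "isCont (\<lambda>s. (U s $ j) (monom 1 k)) t"
proof (induction k rule: less_induct)
  case (less k)
  show ?case
  proof (cases "k < 2")
    case True
    then show ?thesis
      using exhaust_2 [of j] u_normalized [unfolded One_nat_def] unfolding less_2_cases_iff by auto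
  next
    case False
    have "(U s $ j) (monom 1 k) = - (\<Sum>l<k. coeff (p s (Suc k)) l * (U s $ j) (monom 1 l))" for s
    proof -
      have "0 = (U s $ j) (p s (Suc k))"
        using False by (simp add: u_p)
      also have "\<dots> = (\<Sum>l<Suc k. coeff (p s (Suc k)) l * (U s $ j) (monom 1 l))"
        by (rule plinear_expand [OF u_linear]) (rule coeff_p_ge)
      finally show ?thesis
        using coeff_p_lead [of "Suc k" s] by (simp add: eq_neg_iff_add_eq_0 add.commute)
    qed
    moreover have "isCont (\<lambda>s. coeff (p s (Suc k)) l) t" for l
      using pdot [of "Suc k" t] has_vector_derivative_continuous unfolding has_poly_derivative_def by blast
    ultimately show ?thesis
      using less.IH by (auto intro!: continuous_intros)
  qed
qed

section \<open>Condition (d) through its Laurent coefficients\<close>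

definition rate :: "nat \<Rightarrow> 2 \<Rightarrow> real \<Rightarrow> complex" where
  "rate k j t = (U t $ j) (monom 1 (k + 2)) - ((U t $ 1) (monom 1 k) * (U t $ j) (monom 1 2)
       + (U t $ 2) (monom 1 k) * (U t $ j) (monom 1 3))"

lemma evolves_monom_iff:
  "evolves t (monom 1 k) \<longleftrightarrow>
    (\<forall>j. ((\<lambda>s. (U s $ j) (monom 1 k)) has_vector_derivative rate k j t) (at t))"
  unfolding evolves_iff rate_def by (simp add: mult_monom)

lemma rate_bound:
  assumes "l < 2"
  shows "\<exists>D. \<forall>n t j. cmod (rate (2 * n + l) j t) \<le> D * R ^ n"
proof -
  define C where "C = (1 + K) * (1 + K)"
  have bd: "cmod ((U t $ j) (monom 1 (2 * n + l))) \<le> C * R ^ n" if "l < 2" for t j n l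
    unfolding C_def using that by (rule moment_bound)
  have "cmod (rate (2 * n + l) j t) \<le> (C * R + (C * (C * R) + C * (C * R))) * R ^ n" for n t j
  proof -
    have "cmod ((U t $ j) (monom 1 (2 * n + l + 2))) \<le> C * R ^ Suc n"
      using bd [OF assms, where n = "Suc n"] by (simp add: algebra_simps)
    moreover have "cmod ((U t $ 1) (monom 1 (2 * n + l)) * (U t $ j) (monom 1 2)) \<le> C * R ^ n * (C * R)"
      unfolding norm_mult using bd [OF assms] bd [of 0 t j 1] by (intro mult_mono) (auto intro: order_trans [OF norm_ge_zero])
    moreover have "cmod ((U t $ 2) (monom 1 (2 * n + l)) * (U t $ j) (monom 1 3)) \<le> C * R ^ n * (C * R)"
      unfolding norm_mult using bd [OF assms] bd [of 1 t j 1] by (intro mult_mono) (auto intro: order_trans [OF norm_ge_zero])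
    ultimately have "cmod (rate (2 * n + l) j t) \<le> C * R ^ Suc n + (C * R ^ n * (C * R) + C * R ^ n * (C * R))"
      unfolding rate_def by (intro norm_triangle_le_diff norm_triangle_le add_mono order_trans [OF norm_triangle_ineq4] order_trans [OF norm_triangle_ineq])
    then show ?thesis
      by (simp add: algebra_simps)
  qed
  then show ?thesis by blast
qed

definition offset :: "2 \<Rightarrow> nat" where
  "offset i = (if i = 1 then 0 else 1)"

lemma offset_less: "offset i < 2"
  by (simp add: offset_def)

lemma moment_nth: "moment (U t) n $ i $ j = (U t $ j) (monom 1 (2 * n + offset i))"
  using exhaust_2 [of i]
  by (auto simp: moment_def fapply_nth square_Pvec0 offset_def)

lemma markov_nth:
  assumes "cmod z > R"
  shows "(\<lambda>n. (U t $ j) (monom 1 (2 * n + offset i)) / z ^ (n + 1)) sums markov (U t) z $ i $ j"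
proof -
  have s: "summable (\<lambda>n. (U t $ j) (monom 1 (2 * n + offset i)) / z ^ (n + 1))" for i j
    using R_nonneg assms moment_bound [OF offset_less] by (rule summable_inverse_powers(3))
  define M :: "complex^2^2" where
    "M = (\<chi> i j. \<Sum>n. (U t $ j) (monom 1 (2 * n + offset i)) / z ^ (n + 1))"
  have "(\<lambda>n. map_matrix (\<lambda>u. u / z ^ (n + 1)) (moment (U t) n)) sums M"
    unfolding sums_def
  proof (intro vec_tendstoI)
    fix i j
    show "(\<lambda>N. (\<Sum>n<N. map_matrix (\<lambda>u. u / z ^ (n + 1)) (moment (U t) n)) $ i $ j) \<longlonglongrightarrow> M $ i $ j"
      using summable_sums [OF s [of j i]]
      by (simp add: sums_def M_def map_matrix_def moment_nth)
  qed
  then have "markov (U t) z = M"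
    unfolding markov_def by (simp add: sums_iff)
  then show ?thesis
    using summable_sums [OF s] by (simp add: M_def)
qed

text \<open>Multiplication by \<open>z\<close> shifts the series: the sum of
  \<open>U_(n+1) / z^(n+1)\<close> is \<open>z F - U_0\<close>, and \<open>U_0 = I\<close> is the
  identity matrix subtracted in (d).\<close>

lemma markov_rate:
  assumes "cmod z > R"
  shows "(\<lambda>n. rate (2 * n + offset i) j t / z ^ (n + 1)) sums
    ((markov (U t) z ** (mat z - moment (U t) 1) - mat 1) $ i $ j)"
proof -
  have z: "z \<noteq> 0" using assms R_nonneg by auto
  let ?F = "markov (U t) z"
  let ?f = "\<lambda>n j. (U t $ j) (monom 1 (2 * n + offset i))"
  have "(\<lambda>n. ?f (Suc n) j / z ^ (Suc n + 1)) sums (?F $ i $ j - ?f 0 j / z)"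
    using markov_nth [OF assms, of t j i] by (subst sums_Suc_iff) simp
  then have "(\<lambda>n. z * (?f (Suc n) j / z ^ (Suc n + 1))) sums (z * (?F $ i $ j - ?f 0 j / z))"
    by (rule sums_mult)
  then have 1: "(\<lambda>n. ?f (Suc n) j / z ^ (n + 1)) sums (z * ?F $ i $ j - ?f 0 j)"
    using z by (simp add: right_diff_distrib)
  have 2: "(\<lambda>n. ?f n 1 / z ^ (n + 1) * (U t $ j) (monom 1 2) + ?f n 2 / z ^ (n + 1) * (U t $ j) (monom 1 3))
      sums (?F $ i $ 1 * (U t $ j) (monom 1 2) + ?F $ i $ 2 * (U t $ j) (monom 1 3))"
    by (intro sums_add sums_mult2 markov_nth assms)
  have "rate (2 * n + offset i) j t / z ^ (n + 1) = ?f (Suc n) j / z ^ (n + 1) -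
      (?f n 1 / z ^ (n + 1) * (U t $ j) (monom 1 2) + ?f n 2 / z ^ (n + 1) * (U t $ j) (monom 1 3))" for n
    by (simp add: rate_def diff_divide_distrib add_divide_distrib add.commute)
  moreover have "(?F ** (mat z - moment (U t) 1) - mat 1) $ i $ j = (z * ?F $ i $ j - ?f 0 j) -
      (?F $ i $ 1 * (U t $ j) (monom 1 2) + ?F $ i $ 2 * (U t $ j) (monom 1 3))"
    using exhaust_2 [of i] exhaust_2 [of j] u_normalized [of t]
    by (auto simp: matrix_matrix_mult_def sum_2 moment_nth offset_def mat_def algebra_simps numeral_2_eq_2 numeral_3_eq_3)
  ultimately show ?thesis
    using sums_diff [OF 1 2] by simp
qed

lemma markov_evolution_iff: "markov_evolution Jm U \<longleftrightarrow> (\<forall>t k. evolves t (monom 1 k))"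
proof -
  have "markov_evolution Jm U \<longleftrightarrow> (\<forall>i j t z. cmod z > R \<longrightarrow>
      ((\<lambda>s. \<Sum>n. (U s $ j) (monom 1 (2 * n + offset i)) / z ^ (n + 1)) has_vector_derivative
       (\<Sum>n. rate (2 * n + offset i) j t / z ^ (n + 1))) (at t))"
  proof -
    have "((\<lambda>s. markov (U s) z) has_vector_derivative
        markov (U t) z ** (mat z - moment (U t) 1) - mat 1) (at t) \<longleftrightarrow> (\<forall>i j.
      ((\<lambda>s. \<Sum>n. (U s $ j) (monom 1 (2 * n + offset i)) / z ^ (n + 1)) has_vector_derivative
       (\<Sum>n. rate (2 * n + offset i) j t / z ^ (n + 1))) (at t))" if "cmod z > R" for z t
      unfolding has_vector_derivative_vec_iff
        sums_unique [OF markov_nth [OF that], symmetric] sums_unique [OF markov_rate [OF that], symmetric] ..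
    then show ?thesis
      unfolding markov_evolution_def R_def [symmetric] by blast
  qed
  also have "\<dots> \<longleftrightarrow> (\<forall>i j t n.
      ((\<lambda>s. (U s $ j) (monom 1 (2 * n + offset i))) has_vector_derivative rate (2 * n + offset i) j t) (at t))"
  proof (rule all_cong1, rule all_cong1)
    fix i j
    obtain D where D: "\<And>n t. cmod (rate (2 * n + offset i) j t) \<le> D * R ^ n"
      using rate_bound [OF offset_less] by metis
    have "isCont (\<lambda>t. rate (2 * n + offset i) j t) s" for n s
      unfolding rate_def by (intro continuous_intros continuous_u)
    from series_evolution_iff [where f = "\<lambda>n s. (U s $ j) (monom 1 (2 * n + offset i))"
        and g = "\<lambda>n. rate (2 * n + offset i) j", OF R_nonneg moment_bound [OF offset_less] D this]
    show "(\<forall>t z. cmod z > R \<longrightarrow>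
      ((\<lambda>s. \<Sum>n. (U s $ j) (monom 1 (2 * n + offset i)) / z ^ (n + 1)) has_vector_derivative
       (\<Sum>n. rate (2 * n + offset i) j t / z ^ (n + 1))) (at t)) \<longleftrightarrow> (\<forall>t n.
      ((\<lambda>s. (U s $ j) (monom 1 (2 * n + offset i))) has_vector_derivative rate (2 * n + offset i) j t) (at t))" .
  qed
  also have "\<dots> \<longleftrightarrow> (\<forall>i t n. evolves t (monom 1 (2 * n + offset i)))"
    unfolding evolves_monom_iff by blast
  also have "\<dots> \<longleftrightarrow> (\<forall>t k. evolves t (monom 1 k))"
  proof
    assume *: "\<forall>i t n. evolves t (monom 1 (2 * n + offset i))"
    show "\<forall>t k. evolves t (monom 1 k)"
    proof (intro allI)
      fix t and k :: nat
      have "k = 2 * (k div 2) + offset 1 \<or> k = 2 * (k div 2) + offset 2"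
        unfolding offset_def by auto
      then show "evolves t (monom 1 k)" using * by metis
    qed
  qed auto
  finally show ?thesis .
qed

end

theorem theorem3:
  fixes a b c d :: "real \<Rightarrow> nat \<Rightarrow> complex"
    and U :: "real \<Rightarrow> (complex poly \<Rightarrow> complex)^2"
    and J :: "real \<Rightarrow> nat \<Rightarrow> nat \<Rightarrow> complex"
  assumes differentiable:
      "\<And>n t. n \<ge> 1 \<Longrightarrow> (\<lambda>s. a s n) differentiable (at t)"
      "\<And>n t. n \<ge> 1 \<Longrightarrow> (\<lambda>s. b s n) differentiable (at t)"
      "\<And>n t. n \<ge> 1 \<Longrightarrow> (\<lambda>s. c s n) differentiable (at t)"
      "\<And>n t. n \<ge> 1 \<Longrightarrow> (\<lambda>s. d s n) differentiable (at t)"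
    and index_zero: "\<And>t. a t 0 = 0" "\<And>t. b t 0 = 0" "\<And>t. c t 0 = 0" "\<And>t. d t 0 = 0"
    and a1_real: "\<And>t. a t 1 \<in> \<real>"
    and d_nonzero: "\<And>n t. n \<ge> 1 \<Longrightarrow> d t n \<noteq> 0"
    and J: "\<And>t. J t = Jmat (a t) (b t) (c t) (d t)"
    and U_linear: "\<And>t. linear_functionals (U t)"
    and U_normalized: "\<And>t. normalized (U t)"
    and U_orthogonal: "\<And>t. left_orthogonal (a t) (b t) (c t) (d t) (U t)"
    and bounded: "\<exists>K>0. \<forall>n\<ge>1. \<forall>t.
      Max {cmod (a t n), cmod (b t n), cmod (c t n), cmod (d t n)} \<le> K"
    and a1_deriv: "\<And>t. ((\<lambda>s. a s 1) has_vector_derivative c t 1) (at t)"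
  shows
    "(toda_system a b c d \<longleftrightarrow> lax_equation J) \<and>
     (toda_system a b c d \<longleftrightarrow> block_power_evolution J) \<and>
     (toda_system a b c d \<longleftrightarrow> moment_evolution U) \<and>
     (toda_system a b c d \<longleftrightarrow> markov_evolution J U) \<and>
     (toda_system a b c d \<longleftrightarrow> functional_evolution U) \<and>
     (toda_system a b c d \<longleftrightarrow> Bvec_evolution a b c d) \<and>
     (toda_system a b c d \<longleftrightarrow> Vmat_evolution a b c d)"
proof -
  \<comment> \<open>At index 0 the path is constantly 0, so the derivative exists for all indices,
    as \<open>flow\<close> demands.\<close>
  have derivative: "((\<lambda>s. f s n) has_vector_derivative vector_derivative (\<lambda>s. f s n) (at t)) (at t)"
    if "\<And>n t. n \<ge> 1 \<Longrightarrow> (\<lambda>s. f s n) differentiable (at t)" "\<And>t. f t 0 = 0"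
    for f :: tseq and n t
    using that by (cases n) (simp_all add: vector_derivative_works [symmetric])
  obtain K where K: "\<And>n t. n \<ge> 1 \<Longrightarrow> Max {cmod (a t n), cmod (b t n), cmod (c t n), cmod (d t n)} \<le> K"
    using bounded by blast
  interpret bounded_flow a b c d "\<lambda>t n. vector_derivative (\<lambda>s. a s n) (at t)"
    "\<lambda>t n. vector_derivative (\<lambda>s. b s n) (at t)" "\<lambda>t n. vector_derivative (\<lambda>s. c s n) (at t)"
    "\<lambda>t n. vector_derivative (\<lambda>s. d s n) (at t)" U "max 1 K"
  proof
    show "vector_derivative (\<lambda>s. a s 1) (at t) = c t 1" for t
      using a1_deriv by (rule vector_derivative_at)
    fix t and n :: nat
    assume "n \<ge> 1"
    from K [OF this, of t] show "cmod (a t n) \<le> max 1 K" "cmod (b t n) \<le> max 1 K"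
      "cmod (c t n) \<le> max 1 K" "cmod (d t n) \<le> max 1 K"
      by auto
  qed (use assms derivative in auto)
  have J_eq: "J = (\<lambda>t. Jmat (a t) (b t) (c t) (d t))"
    using J by blast
  show ?thesis
    unfolding J_eq lax_iff block_power_evolution_iff moment_evolution_iff markov_evolution_iff
      functional_evolution_iff Bvec_evolution_iff Vmat_evolution_iff toda_iff_residual residual_iff_evolves
    \<comment> \<open>(e) asks for the law at all polynomials, the other conditions for the law at
      monomials.\<close>
    using evolves_monom_imp by auto
qed

end
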